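(* Let $\beta=(\beta_1,\beta_2,\ldots,\beta_d)\vdash n$ where $d\geq 1$ and $\beta_i\geq 3$ for all $i$. Then $$P_{[2,n-2],\beta}(x)=a_{n,\beta}\,\tilde{P}_{\theta_n}(x)+a_{n-1,\beta}\,\tilde{P}_{\theta_{n-1}}(x)+\cdots+a_{1,\beta}\,\tilde{P}_{\theta_1}(x),$$ where, for $1\le i\le n$, $$\tilde{P}_{\theta_i}(x)=2x^2\left[\binom{i+x-2}{i-2}-\binom{x-2}{i-2}\right]+x(x+1)\left[\binom{i+x-2}{i-3}-\binom{x-2}{i-3}\right].$$
   Context: $\mathfrak{S}_n$ is the group of permutations of $[n]$; $\kappa(\pi)$ is the number of disjoint cycles of $\pi$ (fixed points counted). $[2,n-2]$ denotes the partition of $n$ with parts $2$ and $n-2$. $\mathcal{C}_\beta$ is the set of permutations in $\mathfrak{S}_n$ of cycle-type $\beta$. Define $$P_{[2,n-2],\beta}(x)=\frac{n(n-1)}{|\mathcal{C}_\beta|}\sum_{\omega\in\mathcal{C}_\beta}x^{\kappa(\alpha\omega)},$$ where $\alpha\in\mathfrak{S}_n$ is a fixed permutation of cycle-type $[2,n-2]$. Binomial coefficients $\binom{x+a}{r}$ are polynomials in $x$ for $r\geq 0$ and are $0$ for $r<0$. Coefficients $a_{i,\beta}$: for a partition $\gamma=(\gamma_1,\ldots,\gamma_t)\vdash n$ put $\rho(\gamma)=\prod_{i=1}^t(x^{\gamma_i}-y^{\gamma_i})$, and let $\theta_i=[1^{n-i},i]$ be the partition of $n$ with one part $i$ and $n-i$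 further parts equal to $1$. The numbers $a_{n,\beta},\ldots,a_{1,\beta}$ are the coefficients in the expansion $$\rho(\beta)=a_{n,\beta}\,\rho(\theta_n)+a_{n-1,\beta}\,\rho(\theta_{n-1})+\cdots+a_{1,\beta}\,\rho(\theta_1).$$ By a known result they exist and are given by $(a_{n,\beta},a_{n-1,\beta},\ldots,a_{1,\beta})^{T}=M^{-1}(\rho^1_\beta,\rho^2_\beta,\ldots,\rho^n_\beta)^{T}$, where $M$ is the lower triangular $n\times n$ matrix with $(k,s)$ entry $\rho^k_{\theta_{n+1-s}}$, and $$\rho^k_\gamma=\sum_{b_1+\cdots+b_t=k,\ b_i\ge 1}\binom{k}{b_1,\ldots,b_t}(\gamma_1)_{b_1}(\gamma_2)_{b_2}\cdots(\gamma_t)_{b_t},$$ with $(c)_b=c(c-1)\cdots(c-b+1)$. *)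

theory Defs
  imports
    "HOL-Combinatorics.Orbits"
    "HOL-Library.Multiset"
    "HOL-Computational_Algebra.Polynomial"
begin

text \<open>
  Permutations of $[n]$ are functions \<open>p\<close> with \<open>p permutes {1..n}\<close>; their disjoint cycles are the
  sets \<open>orbit p x\<close> for \<open>x \<in> {1..n}\<close>, fixed points giving singletons. A partition of \<open>n\<close> is a
  multiset of positive naturals with sum \<open>n\<close>.
\<close>

definition cycles :: "nat \<Rightarrow> (nat \<Rightarrow> nat) \<Rightarrow> nat set set" where
  "cycles n p = orbit p ` {1..n}"

definition num_cycles :: "nat \<Rightarrow> (nat \<Rightarrow> nat) \<Rightarrow> nat" where
  "num_cycles n p = card (cycles n p)"

definition cycle_type :: "nat \<Rightarrow> (nat \<Rightarrow> nat) \<Rightarrow> nat multiset" where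
  "cycle_type n p = image_mset card (mset_set (cycles n p))"

definition perms_of_type :: "nat \<Rightarrow> nat multiset \<Rightarrow> (nat \<Rightarrow> nat) set" where
  "perms_of_type n \<beta> = {p. p permutes {1..n} \<and> cycle_type n p = \<beta>}"

text \<open>
  $P_{[2,n-2],\beta}$, with the fixed permutation \<open>\<alpha>\<close> of cycle type $[2,n-2]$ as a parameter.
\<close>

definition P_poly :: "nat \<Rightarrow> (nat \<Rightarrow> nat) \<Rightarrow> nat multiset \<Rightarrow> rat poly" where
  "P_poly n \<alpha> \<beta> =
     smult (of_nat (n * (n - 1)) / of_nat (card (perms_of_type n \<beta>)))
       (\<Sum>\<omega>\<in>perms_of_type n \<beta>. monom 1 (num_cycles n (\<alpha> \<circ> \<omega>)))"

text \<open>
  The binomial coefficient ``$x + a$ choose $r$'' as a polynomial in \<open>x\<close>; \<open>poly_pbinom\<close> relates it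
  to \<open>(gchoose)\<close>, which is not available on polynomials.
\<close>

definition pbinom :: "int \<Rightarrow> int \<Rightarrow> rat poly" where
  "pbinom a r =
     (if r < 0 then 0 else smult (1 / fact (nat r)) (\<Prod>k<nat r. [:of_int a - of_nat k, 1:]))"

lemma poly_pbinom:
  "poly (pbinom a r) z = (if r < 0 then 0 else (z + of_int a) gchoose nat r)"
  by (auto simp: pbinom_def poly_prod gbinomial_prod_rev atLeast0LessThan algebra_simps
      intro!: prod.cong)

definition Ptilde :: "nat \<Rightarrow> rat poly" where
  "Ptilde i =
     smult 2 (monom 1 2) * (pbinom (int i - 2) (int i - 2) - pbinom (- 2) (int i - 2))
   + monom 1 1 * (monom 1 1 + 1) * (pbinom (int i - 2) (int i - 3) - pbinom (- 2) (int i - 3))"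

text \<open>\<open>\<rat>[x,y]\<close> is rendered as \<open>rat poly poly\<close>, with \<open>x\<close> the inner and \<open>y\<close> the outer variable.\<close>

definition xvar :: "rat poly poly" where "xvar = [:[:0, 1:]:]"
definition yvar :: "rat poly poly" where "yvar = [:0, 1:]"

definition rho :: "nat multiset \<Rightarrow> rat poly poly" where
  "rho \<gamma> = (\<Prod>g\<in>#\<gamma>. xvar ^ g - yvar ^ g)"

definition theta :: "nat \<Rightarrow> nat \<Rightarrow> nat multiset" where
  "theta n i = replicate_mset (n - i) 1 + {#i#}"

definition is_expansion :: "nat \<Rightarrow> nat multiset \<Rightarrow> (nat \<Rightarrow> rat) \<Rightarrow> bool" where
  "is_expansion n \<beta> a \<longleftrightarrow> rho \<beta> = (\<Sum>i=1..n. smult [:a i:] (rho (theta n i)))"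

text \<open>
  The coefficients $a_{i,\beta}$ for $1 \le i \le n$; they exist and are unique by
  \<open>expansion_ex1\<close>. The value \<open>0\<close> for other \<open>i\<close> is a convention that makes the description definite.
\<close>

definition a_coeff :: "nat \<Rightarrow> nat multiset \<Rightarrow> nat \<Rightarrow> rat" where
  "a_coeff n \<beta> = (THE a. is_expansion n \<beta> a \<and> (\<forall>i. i \<notin> {1..n} \<longrightarrow> a i = 0))"

lemma rho_theta:
  "rho (theta n i) = (xvar - yvar) ^ (n - i) * (xvar ^ i - yvar ^ i)"
  by (simp add: rho_def theta_def)

definition in_span :: "nat \<Rightarrow> rat poly poly \<Rightarrow> bool" where
  "in_span n f \<longleftrightarrow> (\<exists>a. f = (\<Sum>i=1..n. smult [:a i:] (rho (theta n i))))"

lemma in_span_0: "in_span n 0"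
  unfolding in_span_def by (rule exI[of _ "\<lambda>_. 0"]) simp

lemma in_span_add:
  assumes "in_span n f" "in_span n g" shows "in_span n (f + g)"
proof -
  obtain a b where "f = (\<Sum>i=1..n. smult [:a i:] (rho (theta n i)))"
    "g = (\<Sum>i=1..n. smult [:b i:] (rho (theta n i)))"
    using assms unfolding in_span_def by blast
  then have "f + g = (\<Sum>i=1..n. smult [:a i + b i:] (rho (theta n i)))"
    by (simp add: sum.distrib[symmetric] smult_add_left[symmetric])
  then show ?thesis unfolding in_span_def by (intro exI[of _ "\<lambda>i. a i + b i"]) simp
qed

lemma smult_sum_right: "smult c (sum f A) = (\<Sum>i\<in>A. smult c (f i))"
  by (induction A rule: infinite_finite_induct) (simp_all add: smult_add_right)

lemma in_span_smult:
  assumes "in_span n f" shows "in_span n (smult [:c:] f)"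
proof -
  obtain a where "f = (\<Sum>i=1..n. smult [:a i:] (rho (theta n i)))"
    using assms unfolding in_span_def by blast
  then have "smult [:c:] f = (\<Sum>i=1..n. smult [:c * a i:] (rho (theta n i)))"
    by (simp add: smult_sum_right mult.commute)
  then show ?thesis unfolding in_span_def by (intro exI[of _ "\<lambda>i. c * a i"]) simp
qed

lemma in_span_diff:
  assumes "in_span n f" "in_span n g" shows "in_span n (f - g)"
  using in_span_add[OF assms(1) in_span_smult[OF assms(2), of "-1"]]
  by (metis (no_types) diff_conv_add_uminus minus_pCons minus_zero one_pCons smult_1_left
      smult_minus_left)

lemma in_span_sum:
  "(\<And>i. i \<in> A \<Longrightarrow> in_span n (f i)) \<Longrightarrow> in_span n (sum f A)"
  by (induction A rule: infinite_finite_induct) (auto intro: in_span_0 in_span_add)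

lemma in_span_basis:
  assumes "i \<in> {1..n}" shows "in_span n ((xvar - yvar) ^ (n - i) * (xvar ^ i - yvar ^ i))"
proof -
  have "(\<Sum>j=1..n. smult [:if j = i then 1 else 0:] (rho (theta n j)))
      = (\<Sum>j=1..n. if j = i then rho (theta n j) else 0)"
    by (intro sum.cong) (auto simp: one_pCons[symmetric])
  then show ?thesis using assms unfolding in_span_def rho_theta
    by (intro exI[of _ "\<lambda>j. if j = i then 1 else 0"]) auto
qed

lemma in_span_mult_diff:
  assumes "in_span n f" shows "in_span (n + k) ((xvar - yvar) ^ k * f)"
proof -
  obtain a where a: "f = (\<Sum>i=1..n. smult [:a i:] (rho (theta n i)))"
    using assms unfolding in_span_def by blast
  have "(xvar - yvar) ^ k * f
      = (\<Sum>i=1..n. smult [:a i:] ((xvar - yvar) ^ (n + k - i) * (xvar ^ i - yvar ^ i)))"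
    unfolding a sum_distrib_left
  proof (intro sum.cong refl)
    fix i assume "i \<in> {1..n}"
    then have "(xvar - yvar) ^ (n + k - i) = (xvar - yvar) ^ k * (xvar - yvar) ^ (n - i)"
      by (simp add: add.commute flip: power_add)
    then show "(xvar - yvar) ^ k * smult [:a i:] (rho (theta n i))
        = smult [:a i:] ((xvar - yvar) ^ (n + k - i) * (xvar ^ i - yvar ^ i))"
      by (simp add: rho_theta mult_ac)
  qed
  then show ?thesis by (auto intro!: in_span_sum in_span_smult in_span_basis)
qed

lemma in_span_monomial: "j + k + 1 = n \<Longrightarrow> in_span n ((xvar - yvar) * xvar ^ j * yvar ^ k)"
proof (induction n arbitrary: j k)
  case 0 then show ?case by simp
next
  case (Suc n)
  define T where "T j = (xvar - yvar) * xvar ^ j * yvar ^ (n - j)" for j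
  have step: "in_span (Suc n) (T j - T 0)" if "j \<le> n" for j
    using that
  proof (induction j)
    case 0 show ?case by (simp add: in_span_0)
  next
    case (Suc j)
    have "in_span n ((xvar - yvar) * xvar ^ j * yvar ^ (n - Suc j))"
      using Suc.prems by (intro Suc.IH \<open>\<And>j k. j + k + 1 = n \<Longrightarrow> _\<close>) simp
    from in_span_mult_diff[OF this, of 1]
    have "in_span (Suc n) ((xvar - yvar) * ((xvar - yvar) * xvar ^ j * yvar ^ (n - Suc j)))" by simp
    moreover have "(xvar - yvar) * ((xvar - yvar) * xvar ^ j * yvar ^ (n - Suc j)) = T (Suc j) - T j"
    proof -
      have "n - j = Suc (n - Suc j)" using Suc.prems by simp
      then show ?thesis unfolding T_def by (simp add: algebra_simps)
    qed
    ultimately have "in_span (Suc n) (T (Suc j) - T j)" by simp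
    from in_span_add[OF this Suc.IH] Suc.prems show ?case by simp
  qed
  have "xvar ^ Suc n - yvar ^ Suc n = (\<Sum>j\<le>n. T j)"
    unfolding diff_power_eq_sum T_def sum_distrib_left lessThan_Suc_atMost
    by (intro sum.cong) (auto simp: mult_ac)
  also have "\<dots> = (\<Sum>j\<le>n. T j - T 0) + of_nat (Suc n) * T 0"
    by (simp add: sum_subtractf)
  finally have "of_nat (Suc n) * T 0 = (xvar ^ Suc n - yvar ^ Suc n) - (\<Sum>j\<le>n. T j - T 0)"
    by simp
  moreover have "in_span (Suc n) (xvar ^ Suc n - yvar ^ Suc n)"
    using in_span_basis[of "Suc n" "Suc n"] by simp
  ultimately have "in_span (Suc n) (of_nat (Suc n) * T 0)"
    using step by (metis (no_types, lifting) atMost_iff in_span_diff in_span_sum)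
  from in_span_smult[OF this, of "1 / of_nat (Suc n)"]
  have "in_span (Suc n) (T 0)"
    by (simp add: of_nat_poly one_pCons[symmetric] del: of_nat_Suc)
  moreover have "j \<le> n" "n - j = k" using Suc.prems by auto
  ultimately have "in_span (Suc n) (T j)"
    using in_span_add[OF step[of j], of "T 0"] by simp
  then show ?case using \<open>n - j = k\<close> by (simp add: T_def)
qed

lemma in_span_mult_yvar:
  assumes "in_span n f" shows "in_span (Suc n) (yvar * f)"
proof -
  have "in_span (Suc n) (yvar * ((xvar - yvar) ^ (n - i) * (xvar ^ i - yvar ^ i)))" if i: "i \<in> {1..n}" for i
  proof -
    obtain m where m: "i = Suc m" using i by (cases i) auto
    have "yvar * (xvar ^ i - yvar ^ i) = (\<Sum>j\<le>m. (xvar - yvar) * xvar ^ j * yvar ^ (i - j))"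
      unfolding m diff_power_eq_sum sum_distrib_left lessThan_Suc_atMost
      by (intro sum.cong) (auto simp: mult_ac Suc_diff_le)
    moreover have "in_span (Suc i) (\<Sum>j\<le>m. (xvar - yvar) * xvar ^ j * yvar ^ (i - j))"
      by (intro in_span_sum in_span_monomial) (auto simp: m)
    ultimately have "in_span (Suc i) (yvar * (xvar ^ i - yvar ^ i))" by simp
    from in_span_mult_diff[OF this, of "n - i"] i show ?thesis by (simp add: mult_ac)
  qed
  moreover obtain a where "f = (\<Sum>i=1..n. smult [:a i:] (rho (theta n i)))"
    using assms unfolding in_span_def by blast
  ultimately show ?thesis
    by (auto simp: sum_distrib_left rho_theta intro!: in_span_sum in_span_smult)
qed

lemma in_span_mult_xvar:
  assumes "in_span n f" shows "in_span (Suc n) (xvar * f)"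
  using in_span_add[OF in_span_mult_diff[OF assms, of 1, simplified] in_span_mult_yvar[OF assms]]
  by (simp add: algebra_simps)

lemma in_span_mult_power:
  assumes "in_span n f" shows "in_span (n + k) (xvar ^ k * f)" "in_span (n + k) (yvar ^ k * f)"
  using assms by (induction k) (auto simp: mult.assoc intro!: in_span_mult_xvar in_span_mult_yvar)

lemma in_span_rho:
  assumes "\<beta> \<noteq> {#}" shows "in_span (sum_mset \<beta>) (rho \<beta>)"
  using assms
proof (induction \<beta>)
  case (add g \<beta>)
  show ?case
  proof (cases "\<beta> = {#}")
    case True
    then show ?thesis
      using in_span_basis[of g g] by (cases "g = 0") (auto simp: rho_def in_span_0)
  next
    case False
    from in_span_mult_power[OF add.IH[OF this], of g]
    have "in_span (sum_mset \<beta> + g) (xvar ^ g * rho \<beta> - yvar ^ g * rho \<beta>)"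
      by (rule in_span_diff)
    then show ?thesis by (simp add: rho_def algebra_simps)
  qed
qed simp

lemma expansion_zero:
  "(\<Sum>i=1..n. smult [:a i:] (rho (theta n i))) = 0 \<Longrightarrow> i \<in> {1..n} \<Longrightarrow> a i = 0"
proof (induction n arbitrary: i)
  case (Suc n)
  define L where "L = (\<Sum>i=1..n. smult [:a i:] (rho (theta n i)))"
  define Q where "Q = (\<Sum>j<Suc n. yvar ^ (n - j) * xvar ^ j)"
  have "(\<Sum>i=1..n. smult [:a i:] (rho (theta (Suc n) i))) = (xvar - yvar) * L"
    unfolding L_def sum_distrib_left
    by (intro sum.cong) (auto simp: rho_theta Suc_diff_le mult_ac)
  moreover have "rho (theta (Suc n) (Suc n)) = (xvar - yvar) * Q"
    unfolding rho_theta Q_def diff_power_eq_sum by (simp add: mult_ac)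
  ultimately have "(xvar - yvar) * L + smult [:a (Suc n):] ((xvar - yvar) * Q) = 0"
    using Suc.prems(1) by simp
  then have "(xvar - yvar) * (L + smult [:a (Suc n):] Q) = 0"
    by (simp add: distrib_left)
  moreover have "xvar - yvar \<noteq> 0" by (simp add: xvar_def yvar_def)
  ultimately have *: "L + smult [:a (Suc n):] Q = 0" by simp
  have ev: "poly (poly xvar 1) 1 = 1" "poly (poly yvar 1) 1 = 1" by (simp_all add: xvar_def yvar_def)
  have "poly (poly L 1) 1 = 0"
    by (simp add: L_def poly_sum rho_theta ev)
  moreover have "poly (poly Q 1) 1 = of_nat (Suc n)"
    by (simp add: Q_def poly_sum ev)
  ultimately have "a (Suc n) * of_nat (Suc n) = 0"
    using arg_cong[OF *, of "\<lambda>p. poly (poly p 1) 1"] by simp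
  then have an: "a (Suc n) = 0" by (simp del: of_nat_Suc)
  with * have "L = 0" by simp
  then show ?case using Suc.IH Suc.prems(2) an unfolding L_def
    by (cases "i = Suc n") auto
qed simp

lemma expansion_ex1:
  assumes "sum_mset \<beta> = n" "\<beta> \<noteq> {#}"
  shows "\<exists>!a. is_expansion n \<beta> a \<and> (\<forall>i. i \<notin> {1..n} \<longrightarrow> a i = 0)"
proof -
  obtain a where a: "is_expansion n \<beta> a"
    using in_span_rho[OF assms(2)] assms(1) unfolding in_span_def is_expansion_def by auto
  define a' where "a' i = (if i \<in> {1..n} then a i else 0)" for i
  have "(\<Sum>i=1..n. smult [:a' i:] (rho (theta n i))) = (\<Sum>i=1..n. smult [:a i:] (rho (theta n i)))"
    by (intro sum.cong) (auto simp: a'_def)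
  then have a': "is_expansion n \<beta> a' \<and> (\<forall>i. i \<notin> {1..n} \<longrightarrow> a' i = 0)"
    using a by (auto simp: is_expansion_def a'_def)
  show ?thesis
  proof (rule ex1I[of _ a'], rule a')
    fix b assume b: "is_expansion n \<beta> b \<and> (\<forall>i. i \<notin> {1..n} \<longrightarrow> b i = 0)"
    have "(\<Sum>i=1..n. smult [:b i - a' i:] (rho (theta n i)))
        = (\<Sum>i=1..n. smult [:b i:] (rho (theta n i))) - (\<Sum>i=1..n. smult [:a' i:] (rho (theta n i)))"
      unfolding sum_subtractf[symmetric]
      by (intro sum.cong) (auto simp: smult_diff_left[symmetric])
    also have "\<dots> = 0" using b a' by (simp add: is_expansion_def)
    finally have "b i - a' i = 0" if "i \<in> {1..n}" for i
      using expansion_zero[of "\<lambda>i. b i - a' i" n] that by simp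
    then show "b = a'" using b a' by (metis ext eq_iff_diff_eq_0)
  qed
qed

lemma is_expansion_a_coeff:
  assumes "sum_mset \<beta> = n" "\<beta> \<noteq> {#}"
  shows "is_expansion n \<beta> (a_coeff n \<beta>)"
  using theI'[OF expansion_ex1[OF assms]] unfolding a_coeff_def by blast

end

theory Submission
  imports Defs
begin

text \<open>
  Fix the value $z$ of $x$. Specialising $y = 1$ turns $\rho(\gamma)$ into $\prod_i (q^{\gamma_i} - 1)$,
  so a linear functional of $\rho$ becomes a functional $q^k \mapsto g(k)$ on univariate polynomials.

  For a permutation $\sigma$ of a set of size $m$, summing $z^{\kappa(\zeta\sigma)}$ over all
  $m$-cycles $\zeta$ is such a functional of $\rho(\sigma)$, with
  $g(k) = (m-1)!\,\binom{z+k}{m+1}$. This follows by induction on $m$: writing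
  $\zeta = \zeta' (b\;s)$, the transposition joins two cycles of $\sigma$ or splits one, and the
  joins and splits act on $\rho$ as a first-order differential operator.

  A permutation of type $[2,n-2]$ is $\zeta (b\;a)$ with $\zeta$ a full cycle on the complement of
  $\{a,b\}$. Summing over all $a$, $b$, $\zeta$ therefore applies a second-order operator to
  $\rho(\beta)$; the hypothesis $\beta_i \ge 3$ ensures that deleting $a$ and $b$ never removes a whole
  cycle, except for a single fixed point created by the transposition. The resulting functional is
  given by an explicit kernel $\psi_n$ with $\psi_{n+1}(k+1) - \psi_{n+1}(k) = \psi_n(k)$. Since
  multiplication by $q - 1$ is a finite difference of the kernel, its value on $\rho(\theta_i)$ is
  $\psi_i(i) - \psi_i(0) = \tilde P_{\theta_i}(z)$.
\<close>

section \<open>Cycles of a permutation multiplied by a transposition\<close>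

text \<open>Writing \<open>\<zeta> = \<zeta>' \<circ> transpose b s\<close> shrinks the set on which
  the full cycle acts, while the other factor may still move \<open>s\<close>. One ground set for
  both factors is therefore not stable under the induction: two sets \<open>T \<subseteq> S\<close>
  are carried along, and a cycle of the permutation is measured by its number of points in
  \<open>T\<close>. A cycle with no point in \<open>T\<close> must carry \<open>z\<close>, although
  \<open>q^0 - 1 = 0\<close>; these boundary terms are the source of the explicit \<open>z\<close>
  in the kernel identities. The scalar \<open>(m - 1)!\<close> in the kernel can be checked at
  \<open>\<sigma> = id\<close>: there the product is \<open>(q - 1)^m\<close>, the
  \<open>m\<close>-th difference of \<open>(z + k) gchoose (m + 1)\<close> at \<open>k = 0\<close>
  is \<open>z\<close>, and each of the \<open>(m - 1)!\<close> full cycles has one cycle. It is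
  legitimate to sum over \<open>a\<close>, \<open>b\<close>, \<open>\<zeta>\<close> although
  \<open>\<alpha>\<close> is fixed, because the sum over the class of type \<open>\<beta>\<close>
  depends only on the conjugacy class of \<open>\<alpha>\<close>. The factor \<open>n(n - 1)\<close>
  in \<open>P_poly\<close> is the number of pairs \<open>(a, b)\<close>; the \<open>(n - 3)!\<close>
  choices of \<open>\<zeta>\<close> cancel.\<close>

definition cycles_on :: "'a set \<Rightarrow> ('a \<Rightarrow> 'a) \<Rightarrow> 'a set set" where
  "cycles_on S p = orbit p ` S"

lemma orbit_eq_of_mem:
  assumes "p permutes S" "finite S" "y \<in> orbit p x"
  shows "orbit p y = orbit p x"
  using orbit_cyclic_eq3[OF cyclic_on_orbit[OF assms(1,2)] assms(3)] .

lemma mem_orbit_self: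
  assumes "p permutes S" "finite S"
  shows "x \<in> orbit p x"
  using assms by (intro permutation_self_in_orbit) (auto simp: permutation_permutes)

lemma finite_cycles_on [simp]: "finite S \<Longrightarrow> finite (cycles_on S p)"
  by (simp add: cycles_on_def)

lemma cycles_onD:
  assumes "p permutes S" "finite S" "C \<in> cycles_on S p"
  shows "C \<subseteq> S" "C \<noteq> {}" "finite C" "\<And>x. x \<in> C \<Longrightarrow> orbit p x = C"
proof -
  obtain s where s: "s \<in> S" "C = orbit p s" using assms(3) by (auto simp: cycles_on_def)
  show "C \<subseteq> S" using permutes_orbit_subset[OF assms(1) s(1)] s by simp
  then show "finite C" using assms(2) finite_subset by blast
  show "C \<noteq> {}" using s orbit_nonempty by metis
  show "\<And>x. x \<in> C \<Longrightarrow> orbit p x = C" using orbit_eq_of_mem[OF assms(1,2)] s by blast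
qed

lemma cycles_on_disjoint:
  assumes "p permutes S" "finite S" "C \<in> cycles_on S p" "D \<in> cycles_on S p" "C \<noteq> D"
  shows "C \<inter> D = {}"
  using assms cycles_onD(4)[OF assms(1,2)] by blast

lemma Union_cycles_on:
  assumes "p permutes S" "finite S"
  shows "\<Union> (cycles_on S p) = S"
  using mem_orbit_self[OF assms] cycles_onD(1)[OF assms] by (fastforce simp: cycles_on_def)

text \<open>Sums over the points moved by a transposition become sums over cycles weighted by
  length; these weights are what produces Euler operators later.\<close>

lemma sum_over_cycles_on:
  fixes G :: "'a set \<Rightarrow> rat"
  assumes "p permutes S" "finite S" "X \<subseteq> cycles_on S p"
  shows "(\<Sum>a\<in>\<Union>X. G (orbit p a)) = (\<Sum>C\<in>X. of_nat (card C) * G C)"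
proof -
  have "(\<Sum>a\<in>\<Union>X. G (orbit p a)) = (\<Sum>C\<in>X. \<Sum>a\<in>C. G (orbit p a))"
  proof (rule sum.Union_disjoint[unfolded comp_def])
    show "\<forall>C\<in>X. finite C" using assms cycles_onD(3)[OF assms(1,2)] by blast
    show "\<forall>C\<in>X. \<forall>D\<in>X. C \<noteq> D \<longrightarrow> C \<inter> D = {}"
      using assms(3) cycles_on_disjoint[OF assms(1,2)] by blast
  qed
  also have "\<dots> = (\<Sum>C\<in>X. of_nat (card C) * G C)"
    using assms(3) cycles_onD(4)[OF assms(1,2)] by (intro sum.cong) (auto simp: subset_iff)
  finally show ?thesis .
qed

lemma card_Union_cycles_on:
  assumes "p permutes S" "finite S" "X \<subseteq> cycles_on S p"
  shows "card (\<Union>X) = (\<Sum>C\<in>X. card C)"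
proof (rule card_Union_disjoint)
  show "pairwise disjnt X"
    using assms(3) cycles_on_disjoint[OF assms(1,2)] unfolding pairwise_def disjnt_def by blast
  show "\<And>C. C \<in> X \<Longrightarrow> finite C" using assms(3) cycles_onD(3)[OF assms(1,2)] by blast
qed

lemma orbit_card_funpow:
  assumes "p permutes S" "finite S"
  shows "orbit p s = (\<lambda>i. (p ^^ i) s) ` {..<card (orbit p s)}"
    and "inj_on (\<lambda>i. (p ^^ i) s) {..<card (orbit p s)}"
    and "(p ^^ card (orbit p s)) s = s"
    and "card (orbit p s) > 0"
proof -
  have self: "s \<in> orbit p s" by (rule mem_orbit_self[OF assms])
  define N where "N = funpow_dist1 p s s"
  have im: "orbit p s = (\<lambda>i. (p ^^ i) s) ` {0..<N}" and inj: "inj_on (\<lambda>i. (p ^^ i) s) {0..<N}"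
    unfolding N_def by (rule orbit_conv_funpow_dist1[OF self] inj_on_funpow_dist1[OF self])+
  have N: "card (orbit p s) = N" using card_image[OF inj] by (simp add: im)
  show "orbit p s = (\<lambda>i. (p ^^ i) s) ` {..<card (orbit p s)}" "inj_on (\<lambda>i. (p ^^ i) s) {..<card (orbit p s)}"
    using im inj unfolding N by (simp_all add: atLeast0LessThan)
  show "(p ^^ card (orbit p s)) s = s" unfolding N unfolding N_def by (rule funpow_dist1_prop[OF self])
  show "card (orbit p s) > 0" unfolding N by (simp add: N_def)
qed

lemma permutes_transpose_comp:
  fixes p :: "'a \<Rightarrow> 'a"
  assumes "p permutes S" "a \<in> S" "s \<in> S"
  shows "(transpose a s \<circ> p) permutes S"
  using assms by (intro permutes_compose permutes_swap_id)

lemma funpow_transpose_comp: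
  fixes p :: "'a \<Rightarrow> 'a"
  assumes "\<And>j. 0 < j \<Longrightarrow> j < m \<Longrightarrow> (p ^^ j) x \<noteq> a \<and> (p ^^ j) x \<noteq> s" "i < m"
  shows "((transpose a s \<circ> p) ^^ i) x = (p ^^ i) x"
  using assms(2)
proof (induction i)
  case (Suc i)
  have "((transpose a s \<circ> p) ^^ Suc i) x = transpose a s (p (((transpose a s \<circ> p) ^^ i) x))"
    by simp
  also have "\<dots> = transpose a s (p ((p ^^ i) x))"
    by (rule arg_cong[OF Suc.IH[OF Suc_lessD[OF Suc.prems]]])
  also have "\<dots> = (p ^^ Suc i) x" using assms(1)[of "Suc i"] Suc.prems by simp
  finally show ?case .
qed simp

lemma orbit_transpose_comp_other:
  assumes "p permutes S" "finite S" "a \<notin> orbit p x" "s \<notin> orbit p x"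
  shows "orbit (transpose a s \<circ> p) x = orbit p x"
proof (rule orbit_cong)
  show "x \<in> orbit p x" by (rule mem_orbit_self[OF assms(1,2)])
  fix y assume "y \<in> orbit p x"
  then have "p y \<in> orbit p x" by (rule orbit.step)
  then have "p y \<noteq> a" "p y \<noteq> s" using assms by auto
  then show "(transpose a s \<circ> p) y = p y" by simp
qed

text \<open>Left multiplication by the transposition redirects only the arrows entering
  \<open>a\<close> and \<open>s\<close>. The walk from \<open>s\<close> follows \<open>p\<close>
  until it would return to \<open>s\<close>, is sent to \<open>a\<close> instead, runs through the
  cycle of \<open>a\<close>, and is then sent back to \<open>s\<close>.\<close>

lemma orbit_transpose_comp_join:
  assumes "p permutes S" "finite S" "a \<in> S" "s \<in> S" "a \<notin> orbit p s"
  shows "orbit (transpose a s \<circ> p) s = orbit p s \<union> orbit p a"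
proof -
  define \<tau> where "\<tau> = transpose a s \<circ> p"
  have \<tau>: "\<tau> permutes S" unfolding \<tau>_def by (rule permutes_transpose_comp[OF assms(1,3,4)])
  have s_a: "s \<notin> orbit p a"
    using assms(5) orbit_eq_of_mem[OF assms(1,2), of s a] mem_orbit_self[OF assms(1,2), of a] by auto
  have it: "(\<tau> ^^ i) x = (p ^^ i) x" if "x = s \<or> x = a" "i < card (orbit p x)" for i x
    unfolding \<tau>_def
  proof (rule funpow_transpose_comp[OF _ that(2)])
    fix j assume j: "0 < j" "j < card (orbit p x)"
    then have "(p ^^ j) x \<noteq> (p ^^ 0) x"
      using inj_onD[OF orbit_card_funpow(2)[OF assms(1,2), of x], of j 0] by auto
    moreover have "(p ^^ j) x \<in> orbit p x" by (intro funpow_in_orbit mem_orbit_self[OF assms(1,2)])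
    ultimately show "(p ^^ j) x \<noteq> a \<and> (p ^^ j) x \<noteq> s"
      using that(1) assms(5) s_a by (metis funpow_0)
  qed
  have sub: "orbit p x \<subseteq> orbit \<tau> x" if "x = s \<or> x = a" for x
  proof
    fix y assume "y \<in> orbit p x"
    then obtain i where "i < card (orbit p x)" "y = (p ^^ i) x"
      using orbit_card_funpow(1)[OF assms(1,2), of x] by auto
    then show "y \<in> orbit \<tau> x"
      using it[OF that, of i] funpow_in_orbit[OF mem_orbit_self[OF \<tau> assms(2), of x], of i] by simp
  qed
  obtain N where N: "card (orbit p s) = Suc N" using orbit_card_funpow(4)[OF assms(1,2), of s] gr0_implies_Suc by blast
  have "(p ^^ Suc N) s = s" using orbit_card_funpow(3)[OF assms(1,2), of s] N by simp
  then have "p ((p ^^ N) s) = s" by simp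
  moreover have "(\<tau> ^^ Suc N) s = \<tau> ((p ^^ N) s)" using it[of s N] N by simp
  ultimately have "(\<tau> ^^ Suc N) s = a" by (simp add: \<tau>_def)
  then have "a \<in> orbit \<tau> s"
    using funpow_in_orbit[OF mem_orbit_self[OF \<tau> assms(2), of s], of "Suc N"] by simp
  then have "orbit \<tau> a = orbit \<tau> s" by (rule orbit_eq_of_mem[OF \<tau> assms(2)])
  then have "orbit p s \<union> orbit p a \<subseteq> orbit \<tau> s" using sub[of s] sub[of a] by auto
  \<comment> \<open>The union is closed under \<open>p\<close> and under the transposition, hence
    under \<open>\<tau>\<close>.\<close>
  moreover have "orbit \<tau> s \<subseteq> orbit p s \<union> orbit p a"
  proof
    have self: "x \<in> orbit p x" for x by (rule mem_orbit_self[OF assms(1,2)])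
    have tr: "transpose a s y \<in> orbit p s \<union> orbit p a" if "y \<in> orbit p s \<union> orbit p a" for y
      using that self[of a] self[of s] by (cases "y = a"; cases "y = s") auto
    fix y assume "y \<in> orbit \<tau> s"
    then show "y \<in> orbit p s \<union> orbit p a"
    proof induction
      case base
      show ?case unfolding \<tau>_def comp_def by (rule tr) (auto intro: orbit.base)
    next
      case (step y)
      then show ?case unfolding \<tau>_def comp_def by (intro tr) (auto intro: orbit.step)
    qed
  qed
  ultimately show ?thesis unfolding \<tau>_def by auto
qed

lemma cycles_on_transpose_comp_join:
  assumes "p permutes S" "finite S" "a \<in> S" "s \<in> S" "a \<notin> orbit p s"
  shows "cycles_on S (transpose a s \<circ> p)
    = insert (orbit p s \<union> orbit p a) (cycles_on S p - {orbit p s, orbit p a})"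
proof -
  define \<tau> where "\<tau> = transpose a s \<circ> p"
  have \<tau>: "\<tau> permutes S" unfolding \<tau>_def by (rule permutes_transpose_comp[OF assms(1,3,4)])
  have self: "x \<in> orbit p x" for x by (rule mem_orbit_self[OF assms(1,2)])
  have js: "orbit \<tau> s = orbit p s \<union> orbit p a"
    unfolding \<tau>_def by (rule orbit_transpose_comp_join[OF assms])
  have j: "orbit \<tau> x = orbit p s \<union> orbit p a" if "x \<in> orbit p s \<union> orbit p a" for x
    using orbit_eq_of_mem[OF \<tau> assms(2), of x s] that js by simp
  have o: "orbit \<tau> x = orbit p x \<and> orbit p x \<noteq> orbit p s \<and> orbit p x \<noteq> orbit p a" if "x \<notin> orbit p s \<union> orbit p a" for x
  proof -
    have "orbit p x \<noteq> orbit p s" "orbit p x \<noteq> orbit p a" using that self[of x] by auto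
    moreover from this have "s \<notin> orbit p x" "a \<notin> orbit p x"
      using orbit_eq_of_mem[OF assms(1,2), of s x] orbit_eq_of_mem[OF assms(1,2), of a x] by auto
    ultimately show ?thesis unfolding \<tau>_def using orbit_transpose_comp_other[OF assms(1,2)] by simp
  qed
  have "orbit \<tau> ` S = insert (orbit p s \<union> orbit p a) (orbit p ` S - {orbit p s, orbit p a})" (is "?L = ?R")
  proof (intro equalityI subsetI)
    fix C assume "C \<in> ?L"
    then obtain x where "x \<in> S" "C = orbit \<tau> x" by auto
    show "C \<in> ?R"
    proof (cases "x \<in> orbit p s \<union> orbit p a")
      case True
      then show ?thesis using j \<open>C = _\<close> by blast
    next
      case False
      then show ?thesis using o[OF False] \<open>C = _\<close> \<open>x \<in> S\<close> by blast
    qed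
  next
    fix C assume C: "C \<in> ?R"
    show "C \<in> ?L"
    proof (cases "C = orbit p s \<union> orbit p a")
      case True
      then show ?thesis using js assms(4) by (intro image_eqI[of _ _ s]) simp_all
    next
      case False
      then obtain x where x: "x \<in> S" "C = orbit p x" "orbit p x \<noteq> orbit p s" "orbit p x \<noteq> orbit p a" using C by auto
      then have "x \<notin> orbit p s \<union> orbit p a" using orbit_eq_of_mem[OF assms(1,2)] by blast
      then show ?thesis using o[of x] x by (intro image_eqI[of _ _ x]) simp_all
    qed
  qed
  then show ?thesis by (simp add: cycles_on_def \<tau>_def)
qed

text \<open>A second multiplication by the same transposition gives back \<open>p\<close>, so the
  cycles of \<open>p\<close> are a join of cycles of the product and the join lemma can be read
  backwards. Only the piece \<open>D\<close>, consisting of \<open>s, p s, ..., p^(d-1) s\<close>,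
  is computed directly, because its size is needed.\<close>

lemma cycles_on_transpose_comp_split:
  assumes "p permutes S" "finite S" "s \<in> S" "0 < d" "d < card (orbit p s)"
  obtains D where "cycles_on S (transpose ((p ^^ d) s) s \<circ> p)
      = insert D (insert (orbit p s - D) (cycles_on S p - {orbit p s}))"
    "D \<subseteq> orbit p s" "card D = d" "s \<in> D" "(p ^^ d) s \<notin> D"
proof -
  define a where "a = (p ^^ d) s"
  define \<tau> where "\<tau> = transpose a s \<circ> p"
  define D where "D = orbit \<tau> s"
  have aS: "a \<in> S" unfolding a_def using permutes_orbit_subset[OF assms(1,3)] funpow_in_orbit[OF mem_orbit_self[OF assms(1,2)]] by blast
  have \<tau>: "\<tau> permutes S" unfolding \<tau>_def by (rule permutes_transpose_comp[OF assms(1) aS assms(3)])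
  have inj: "(p ^^ i) s \<noteq> (p ^^ j) s" if "i < card (orbit p s)" "j < card (orbit p s)" "i \<noteq> j" for i j
    using inj_onD[OF orbit_card_funpow(2)[OF assms(1,2), of s], of i j] that by auto
  have it: "(\<tau> ^^ i) s = (p ^^ i) s" if "i < d" for i
    unfolding \<tau>_def
  proof (rule funpow_transpose_comp[OF _ that])
    fix j assume "0 < j" "j < d"
    then show "(p ^^ j) s \<noteq> a \<and> (p ^^ j) s \<noteq> s"
      using inj[of j d] inj[of j 0] assms unfolding a_def by auto
  qed
  obtain e where e: "d = Suc e" using assms(4) gr0_implies_Suc by blast
  have "(\<tau> ^^ d) s = \<tau> ((p ^^ e) s)" using it[of e] by (simp add: e)
  also have "\<dots> = s" by (simp add: \<tau>_def a_def e)
  finally have "(\<tau> ^^ d) s = s" .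
  then have "D = {(\<tau> ^^ m) s |m. m < d}" unfolding D_def by (rule orbit_altdef_bounded) fact
  also have "\<dots> = (\<lambda>i. (\<tau> ^^ i) s) ` {..<d}" by auto
  also have "\<dots> = (\<lambda>i. (p ^^ i) s) ` {..<d}" using it by (intro image_cong) auto
  finally have D: "D = (\<lambda>i. (p ^^ i) s) ` {..<d}" .
  have cD: "card D = d"
    unfolding D using assms(5) inj_on_subset[OF orbit_card_funpow(2)[OF assms(1,2), of s], of "{..<d}"]
    by (subst card_image) auto
  have sD: "s \<in> D" unfolding D_def by (rule mem_orbit_self[OF \<tau> assms(2)])
  have aD: "a \<notin> D"
  proof
    assume "a \<in> D"
    then obtain i where "i < d" "(p ^^ d) s = (p ^^ i) s" unfolding D a_def by auto
    then show False using inj[of d i] assms(5) by simp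
  qed
  have "transpose a s \<circ> \<tau> = p" by (auto simp: \<tau>_def fun_eq_iff)
  then have js: "orbit p s = D \<union> orbit \<tau> a" and jc: "cycles_on S p = insert (D \<union> orbit \<tau> a) (cycles_on S \<tau> - {D, orbit \<tau> a})"
    using orbit_transpose_comp_join[OF \<tau> assms(2) aS assms(3)]
      cycles_on_transpose_comp_join[OF \<tau> assms(2) aS assms(3)] aD unfolding D_def by auto
  have in\<tau>: "D \<in> cycles_on S \<tau>" "orbit \<tau> a \<in> cycles_on S \<tau>" using assms aS by (auto simp: cycles_on_def D_def)
  have "D \<noteq> orbit \<tau> a" using aD mem_orbit_self[OF \<tau> assms(2), of a] by auto
  then have dis: "D \<inter> orbit \<tau> a = {}" using cycles_on_disjoint[OF \<tau> assms(2) in\<tau>] by simp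
  \<comment> \<open>Otherwise removing \<open>orbit p s\<close> from the joined family would also
    remove one of the untouched cycles.\<close>
  have "D \<union> orbit \<tau> a \<notin> cycles_on S \<tau> - {D, orbit \<tau> a}"
  proof
    assume A: "D \<union> orbit \<tau> a \<in> cycles_on S \<tau> - {D, orbit \<tau> a}"
    then have "D \<inter> (D \<union> orbit \<tau> a) = {}" using cycles_on_disjoint[OF \<tau> assms(2) in\<tau>(1), of "D \<union> orbit \<tau> a"] by auto
    then show False using sD by auto
  qed
  then have "cycles_on S p - {orbit p s} = cycles_on S \<tau> - {D, orbit \<tau> a}" unfolding jc js by auto
  moreover have "orbit p s - D = orbit \<tau> a" using js dis by auto
  ultimately have "cycles_on S \<tau> = insert D (insert (orbit p s - D) (cycles_on S p - {orbit p s}))"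
    using in\<tau> by auto
  then show ?thesis using that cD sD aD js unfolding \<tau>_def a_def by blast
qed

section \<open>Fixed points and the erasure of a point from a permutation\<close>

lemma cycles_on_fixed:
  assumes "p permutes S" "finite S" "s \<in> S" "p s = s"
  shows "cycles_on (S - {s}) p = cycles_on S p - {{s}}" "{s} \<in> cycles_on S p"
proof -
  have o: "orbit p s = {s}" using assms by (simp add: orbit_eq_singleton_iff)
  have "orbit p x \<noteq> {s}" if "x \<noteq> s" for x using mem_orbit_self[OF assms(1,2), of x] that by auto
  then show "cycles_on (S - {s}) p = cycles_on S p - {{s}}" using o by (auto simp: cycles_on_def)
  show "{s} \<in> cycles_on S p" using o assms by (auto simp: cycles_on_def)
qed

text \<open>In cycle notation this erases \<open>s\<close>: the predecessor of \<open>s\<close> is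
  sent to \<open>p s\<close>, and \<open>s\<close> becomes a fixed point.\<close>

definition perm_delete :: "'a \<Rightarrow> ('a \<Rightarrow> 'a) \<Rightarrow> 'a \<Rightarrow> 'a" where
  "perm_delete s p = transpose s (p s) \<circ> p"

lemma perm_delete_permutes:
  assumes "p permutes S" "s \<in> S"
  shows "perm_delete s p permutes (S - {s})"
proof -
  have "p s \<in> S" using assms by (simp add: permutes_in_image)
  then have "perm_delete s p permutes S" unfolding perm_delete_def using assms by (simp add: permutes_transpose_comp)
  then have "perm_delete s p permutes insert s (S - {s})" using assms by (simp add: insert_absorb)
  moreover have "perm_delete s p s = s" by (simp add: perm_delete_def)
  ultimately show ?thesis by (metis permutes_superset Diff_iff insertE singletonI)
qed

text \<open>If \<open>s\<close> is moved, this is the split with \<open>d = 1\<close>, whose piece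
  \<open>D\<close> is \<open>{s}\<close>.\<close>

lemma cycles_on_perm_delete:
  assumes "p permutes S" "finite S" "s \<in> S"
  shows "cycles_on (S - {s}) (perm_delete s p)
    = (cycles_on S p - {orbit p s}) \<union> (if p s = s then {} else {orbit p s - {s}})"
proof (cases "p s = s")
  case True
  then have "orbit p s = {s}" "perm_delete s p = p" by (auto simp: orbit_eq_singleton_iff perm_delete_def)
  then show ?thesis using True cycles_on_fixed[OF assms True] by simp
next
  case False
  define \<tau> where "\<tau> = perm_delete s p"
  have eq: "\<tau> = transpose ((p ^^ 1) s) s \<circ> p" by (simp add: \<tau>_def perm_delete_def transpose_commute)
  have "p s \<in> S" using assms by (simp add: permutes_in_image)
  then have \<tau>: "\<tau> permutes S" unfolding \<tau>_def perm_delete_def using assms by (simp add: permutes_transpose_comp)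
  have \<tau>s: "\<tau> s = s" by (simp add: \<tau>_def perm_delete_def)
  have "card (orbit p s) \<noteq> 1"
  proof
    assume "card (orbit p s) = 1"
    then obtain x where "orbit p s = {x}" using card_1_singletonE by blast
    then have "orbit p s = {s}" using mem_orbit_self[OF assms(1,2), of s] by auto
    then show False using False by (simp add: orbit_eq_singleton_iff)
  qed
  then have "1 < card (orbit p s)" using orbit_card_funpow(4)[OF assms(1,2), of s] by linarith
  then obtain D where D: "cycles_on S \<tau> = insert D (insert (orbit p s - D) (cycles_on S p - {orbit p s}))"
     "card D = 1" "s \<in> D"
    unfolding eq using cycles_on_transpose_comp_split[OF assms, of 1] by (metis zero_less_one)
  have Ds: "D = {s}" using D(2,3) card_1_singletonE by (metis singletonD)
  have "cycles_on (S - {s}) \<tau> = cycles_on S \<tau> - {{s}}" by (rule cycles_on_fixed[OF \<tau> assms(2,3) \<tau>s])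
  also have "\<dots> = insert (orbit p s - {s}) (cycles_on S p - {orbit p s})"
  proof -
    have "{s} \<notin> cycles_on S p - {orbit p s}"
      using cycles_onD(4)[OF assms(1,2), of "{s}" s] by auto
    then show ?thesis unfolding D(1) Ds by auto
  qed
  finally show ?thesis using False by (simp add: \<tau>_def)
qed


lemma card_cycles_on_perm_delete:
  assumes "p permutes S" "finite S" "s \<in> S"
  shows "card (cycles_on S p) = card (cycles_on (S - {s}) (perm_delete s p)) + (if p s = s then 1 else 0)"
proof -
  have o: "orbit p s \<in> cycles_on S p" using assms by (simp add: cycles_on_def)
  then have c: "card (cycles_on S p) = Suc (card (cycles_on S p - {orbit p s}))"
    using assms(2) by (intro card.remove) simp_all
  show ?thesis
  proof (cases "p s = s")
    case True
    then show ?thesis using c cycles_on_perm_delete[OF assms] by simp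
  next
    case False
    \<comment> \<open>The shortened cycle still contains \<open>p s\<close>, so it cannot coincide
      with another cycle and the count stays the same.\<close>
    have "orbit p s - {s} \<notin> cycles_on S p - {orbit p s}"
    proof
      assume A: "orbit p s - {s} \<in> cycles_on S p - {orbit p s}"
      have "p s \<in> orbit p s - {s}" using False orbit.base[of p s] by simp
      then have "orbit p s \<inter> (orbit p s - {s}) \<noteq> {}" by blast
      moreover have "orbit p s \<inter> (orbit p s - {s}) = {}"
        using A by (intro cycles_on_disjoint[OF assms(1,2) o]) auto
      ultimately show False by simp
    qed
    then show ?thesis using c cycles_on_perm_delete[OF assms] False assms(2) by simp
  qed
qed

text \<open>A point fixed by the full cycle can thus be erased from the product by erasing it from
  the right factor alone.\<close>

lemma perm_delete_comp:
  assumes "\<zeta> s = s" "inj \<zeta>"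
  shows "perm_delete s (\<zeta> \<circ> p) = \<zeta> \<circ> perm_delete s p"
proof
  fix x
  have i: "\<zeta> u = \<zeta> v \<longleftrightarrow> u = v" for u v using assms(2) by (auto dest: injD)
  have "\<zeta> u = s \<longleftrightarrow> u = s" for u using i[of u s] assms(1) by simp
  with i show "perm_delete s (\<zeta> \<circ> p) x = (\<zeta> \<circ> perm_delete s p) x"
    by (auto simp: perm_delete_def transpose_def assms(1))
qed

section \<open>Full cycles on a set and their recursive enumeration\<close>

definition full_cycles :: "'a set \<Rightarrow> ('a \<Rightarrow> 'a) set" where
  "full_cycles T = {\<zeta>. \<zeta> permutes T \<and> cycles_on T \<zeta> = {T}}"

lemma finite_full_cycles [simp]: "finite T \<Longrightarrow> finite (full_cycles T)"
  unfolding full_cycles_def by (rule finite_subset[OF _ finite_permutations[of T]]) auto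

lemma full_cycles_singleton: "full_cycles {s} = {id}"
proof -
  have "orbit id s = {s}" by (simp add: orbit_eq_singleton_iff)
  moreover have "p permutes {s} \<Longrightarrow> p = id" for p :: "'a \<Rightarrow> 'a"
    by (rule permutes_sing[THEN iffD1])
  ultimately show ?thesis by (auto simp: full_cycles_def cycles_on_def permutes_id)
qed

text \<open>Since \<open>\<zeta>\<close> fixes \<open>s\<close>, multiplying by
  \<open>transpose b s\<close> on the right is multiplying by \<open>transpose (\<zeta> b) s\<close>
  on the left, and there the join lemma merges the two cycles \<open>S - {s}\<close> and
  \<open>{s}\<close>.\<close>

lemma full_cycles_extend:
  assumes "finite S" "s \<in> S" "\<zeta> \<in> full_cycles (S - {s})" "b \<in> S - {s}"
  shows "\<zeta> \<circ> transpose b s \<in> full_cycles S"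
proof -
  have \<zeta>': "\<zeta> permutes (S - {s})" and c': "cycles_on (S - {s}) \<zeta> = {S - {s}}"
    using assms(3) by (auto simp: full_cycles_def)
  have \<zeta>: "\<zeta> permutes S" using permutes_subset[OF \<zeta>'] by blast
  have fs: "\<zeta> s = s" using permutes_not_in[OF \<zeta>'] by simp
  have c: "cycles_on S \<zeta> = {S - {s}, {s}}"
    using cycles_on_fixed[OF \<zeta> assms(1,2) fs] c' by blast
  have b: "\<zeta> b \<in> S - {s}" using permutes_in_image[OF \<zeta>', of b] assms(4) by simp
  have os: "orbit \<zeta> s = {s}" using fs by (simp add: orbit_eq_singleton_iff)
  have ob: "orbit \<zeta> (\<zeta> b) = S - {s}"
    by (rule cycles_onD(4)[OF \<zeta> assms(1) _ b]) (simp add: c)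
  have "\<zeta> \<circ> transpose b s = transpose (\<zeta> b) s \<circ> \<zeta>"
    using transpose_comp_eq[OF permutes_bij[OF \<zeta>], of "\<zeta> b" "\<zeta> s"] permutes_inverses(2)[OF \<zeta>, of b]
      permutes_inverses(2)[OF \<zeta>, of s] fs by simp
  moreover have "cycles_on S (transpose (\<zeta> b) s \<circ> \<zeta>) = {S}"
    using cycles_on_transpose_comp_join[OF \<zeta> assms(1) _ assms(2), of "\<zeta> b"] b os ob c assms(2)
    by (auto simp: insert_absorb)
  moreover have "(transpose (\<zeta> b) s \<circ> \<zeta>) permutes S"
    using permutes_transpose_comp[OF \<zeta> _ assms(2)] b by simp
  ultimately show ?thesis by (simp add: full_cycles_def)
qed

text \<open>Here \<open>b\<close> is the preimage of \<open>s\<close> and \<open>\<zeta>'\<close> is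
  \<open>\<zeta>\<close> with \<open>s\<close> erased; \<open>b\<close> differs from
  \<open>s\<close> because a full cycle on more than one point has no fixed point.\<close>

lemma full_cycles_reduce:
  assumes "finite S" "s \<in> S" "S \<noteq> {s}" "\<zeta> \<in> full_cycles S"
  obtains b \<zeta>' where "b \<in> S - {s}" "\<zeta>' \<in> full_cycles (S - {s})" "\<zeta> = \<zeta>' \<circ> transpose b s"
proof -
  have \<zeta>: "\<zeta> permutes S" and c: "cycles_on S \<zeta> = {S}" using assms(4) by (auto simp: full_cycles_def)
  obtain b where b: "b \<in> S" "\<zeta> b = s"
    using permutes_image[OF \<zeta>] assms(2) by (metis imageE)
  have os: "orbit \<zeta> s = S" by (rule cycles_onD(4)[OF \<zeta> assms(1) _ assms(2)]) (simp add: c)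
  have ns: "\<zeta> s \<noteq> s"
  proof
    assume "\<zeta> s = s"
    then have "orbit \<zeta> s = {s}" by (simp add: orbit_eq_singleton_iff)
    then show False using os assms(3) by simp
  qed
  then have bs: "b \<in> S - {s}" using b by auto
  have "perm_delete s \<zeta> \<in> full_cycles (S - {s})"
    using perm_delete_permutes[OF \<zeta> assms(2)] cycles_on_perm_delete[OF \<zeta> assms(1,2)] ns os c
    by (simp add: full_cycles_def)
  moreover have "\<zeta> = perm_delete s \<zeta> \<circ> transpose b s"
  proof
    fix x
    have "\<zeta> x = s \<longleftrightarrow> x = b" "\<zeta> x = \<zeta> s \<longleftrightarrow> x = s"
      using b(2) permutes_inj[OF \<zeta>] by (auto dest: injD)
    then show "\<zeta> x = (perm_delete s \<zeta> \<circ> transpose b s) x"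
      using b(2) bs ns by (cases "x = b"; cases "x = s") (auto simp: perm_delete_def)
  qed
  ultimately show ?thesis using that bs by blast
qed

lemma sum_full_cycles:
  fixes F :: "('a \<Rightarrow> 'a) \<Rightarrow> rat"
  assumes "finite S" "s \<in> S" "S \<noteq> {s}"
  shows "sum F (full_cycles S) = (\<Sum>b\<in>S - {s}. \<Sum>\<zeta>\<in>full_cycles (S - {s}). F (\<zeta> \<circ> transpose b s))"
proof -
  have "inj_on (\<lambda>(b, \<zeta>). \<zeta> \<circ> transpose b s) ((S - {s}) \<times> full_cycles (S - {s}))"
  proof (rule inj_onI)
    fix x y
    assume xy: "x \<in> (S - {s}) \<times> full_cycles (S - {s})" "y \<in> (S - {s}) \<times> full_cycles (S - {s})"
      "(\<lambda>(b, \<zeta>). \<zeta> \<circ> transpose b s) x = (\<lambda>(b, \<zeta>). \<zeta> \<circ> transpose b s) y"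
    obtain b \<zeta> b' \<zeta>' where p: "x = (b, \<zeta>)" "y = (b', \<zeta>')" by (cases x; cases y) auto
    then have A: "\<zeta> \<in> full_cycles (S - {s})" "\<zeta>' \<in> full_cycles (S - {s})"
      and eq: "\<zeta> \<circ> transpose b s = \<zeta>' \<circ> transpose b' s"
      using xy by auto
    have "\<zeta> permutes (S - {s})" "\<zeta>' permutes (S - {s})" using A by (auto simp: full_cycles_def)
    then have fs: "\<zeta> s = s" "\<zeta>' s = s" "inj \<zeta>" by (simp_all add: permutes_not_in permutes_inj)
    \<comment> \<open>The product determines \<open>b\<close> as the point that it sends to
      \<open>s\<close>, so evaluation at \<open>b'\<close> identifies the two.\<close>
    have "\<zeta> (transpose b s b') = \<zeta> s"
      using fun_cong[OF eq, of b'] fs by simp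
    then have "transpose b s b' = s" using fs(3) by (auto dest: injD)
    then have bb: "b = b'" by (metis transpose_involutory transpose_apply_second)
    have "\<zeta> \<circ> transpose b s \<circ> transpose b s = \<zeta>' \<circ> transpose b s \<circ> transpose b s" using eq bb by simp
    then have "\<zeta> = \<zeta>'" by (simp add: comp_assoc)
    then show "x = y" using bb p by simp
  qed
  moreover have "(\<lambda>(b, \<zeta>). \<zeta> \<circ> transpose b s) ` ((S - {s}) \<times> full_cycles (S - {s})) = full_cycles S"
  proof (intro equalityI subsetI)
    fix \<zeta> assume "\<zeta> \<in> full_cycles S"
    then show "\<zeta> \<in> (\<lambda>(b, \<zeta>). \<zeta> \<circ> transpose b s) ` ((S - {s}) \<times> full_cycles (S - {s}))"
      by (rule full_cycles_reduce[OF assms]) auto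
  qed (use full_cycles_extend[OF assms(1,2)] in auto)
  ultimately have "sum F (full_cycles S) = (\<Sum>x\<in>(S - {s}) \<times> full_cycles (S - {s}). F ((\<lambda>(b, \<zeta>). \<zeta> \<circ> transpose b s) x))"
    by (metis (no_types, lifting) sum.reindex_cong)
  then show ?thesis by (simp add: sum.cartesian_product case_prod_beta')
qed

lemma card_full_cycles:
  assumes "finite T" "T \<noteq> {}"
  shows "card (full_cycles T) = fact (card T - 1)"
  using assms
proof (induction T rule: finite_ne_induct)
  case (singleton x)
  then show ?case by (simp add: full_cycles_singleton)
next
  case (insert x T)
  have "(\<Sum>\<zeta>\<in>full_cycles (insert x T). 1 :: rat) = of_nat (card T) * of_nat (card (full_cycles T))"
    using sum_full_cycles[of "insert x T" x "\<lambda>_. 1"] insert by (simp, fastforce)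
  then have "(of_nat (card (full_cycles (insert x T))) :: rat) = of_nat (card T * card (full_cycles T))" by simp
  then have "card (full_cycles (insert x T)) = card T * card (full_cycles T)" using of_nat_eq_iff by blast
  also have "\<dots> = fact (card T)"
    using insert by (metis card_gt_0_iff fact_num_eq_if neq0_conv of_nat_id)
  finally show ?case using insert by simp
qed

section \<open>Linear functionals on polynomials\<close>

text \<open>Operators on polynomials turn into operations on the kernel \<open>g\<close>:
  multiplication by \<open>q^c\<close> shifts its argument by \<open>c\<close>, and
  \<open>q d/dq\<close> multiplies it by \<open>k\<close>.\<close>

definition pairing :: "(nat \<Rightarrow> rat) \<Rightarrow> rat poly \<Rightarrow> rat" where
  "pairing g f = (\<Sum>k\<le>degree f. coeff f k * g k)"

lemma pairing_bound:
  assumes "degree f \<le> N"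
  shows "pairing g f = (\<Sum>k\<le>N. coeff f k * g k)"
  unfolding pairing_def using assms
  by (intro sum.mono_neutral_left) (auto simp: coeff_eq_0)

lemma pairing_0 [simp]: "pairing g 0 = 0"
  by (simp add: pairing_def)

lemma pairing_1 [simp]: "pairing g 1 = g 0"
  by (simp add: pairing_def)

lemma pairing_add: "pairing g (f + h) = pairing g f + pairing g h"
proof -
  define N where "N = max (degree f) (degree h)"
  have "degree (f + h) \<le> N" "degree f \<le> N" "degree h \<le> N"
    unfolding N_def by (auto intro: degree_add_le_max)
  then show ?thesis by (simp add: pairing_bound algebra_simps sum.distrib)
qed

lemma pairing_smult: "pairing g (smult c f) = c * pairing g f"
proof -
  have "degree (smult c f) \<le> degree f" by (rule degree_smult_le)
  then show ?thesis by (simp add: pairing_bound[of _ "degree f"] sum_distrib_left mult.assoc)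
qed

lemma pairing_minus: "pairing g (- f) = - pairing g f"
  using pairing_smult[of g "-1" f] by simp

lemma pairing_diff: "pairing g (f - h) = pairing g f - pairing g h"
  using pairing_add[of g f "- h"] by (simp add: pairing_minus)

lemma pairing_sum: "pairing g (sum f A) = (\<Sum>i\<in>A. pairing g (f i))"
  by (induction A rule: infinite_finite_induct) (simp_all add: pairing_add)

lemma pairing_lincomb: "pairing (\<lambda>k. c * g k + d * h k) f = c * pairing g f + d * pairing h f"
  by (simp add: pairing_def sum_distrib_left sum.distrib[symmetric] algebra_simps)

lemma pairing_mult_const: "pairing g ([:c:] * f) = c * pairing g f"
  by (simp add: pairing_smult)

lemma pairing_pCons: "pairing g (pCons a f) = a * g 0 + pairing (\<lambda>k. g (Suc k)) f"
proof -
  have "pairing g (pCons a f) = (\<Sum>k\<le>Suc (degree f). coeff (pCons a f) k * g k)"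
    by (rule pairing_bound) (rule degree_pCons_le)
  then show ?thesis unfolding sum.atMost_Suc_shift by (simp add: pairing_def)
qed

lemma pairing_monom_mult: "pairing g (monom 1 c * f) = pairing (\<lambda>k. g (k + c)) f"
proof (induction c arbitrary: g)
  case (Suc c)
  have "monom 1 (Suc c) * f = pCons 0 (monom 1 c * f)"
    by (simp add: monom_Suc)
  then show ?case by (simp add: pairing_pCons Suc)
qed simp

lemma pairing_pderiv: "pairing g (monom 1 1 * pderiv f) = pairing (\<lambda>k. of_nat k * g k) f"
proof -
  have c: "coeff (monom 1 1 * pderiv f) k = of_nat k * coeff f k" for k
    by (cases k) (simp_all add: monom_Suc coeff_pderiv)
  have "degree (monom 1 1 * pderiv f) \<le> degree f"
    by (rule degree_le) (simp add: c[unfolded One_nat_def] coeff_eq_0)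
  then have "pairing g (monom 1 1 * pderiv f) = (\<Sum>k\<le>degree f. of_nat k * coeff f k * g k)"
    by (simp only: pairing_bound c)
  then show ?thesis by (simp add: pairing_def mult_ac)
qed

section \<open>Euler operators and the sums over joins and splits\<close>

abbreviation qfac :: "nat \<Rightarrow> rat poly" where "qfac c \<equiv> monom 1 c - 1"

lemma euler_prod_qfac:
  assumes "finite X"
  shows "monom 1 1 * pderiv (\<Prod>C\<in>X. qfac (m C)) =
    (\<Sum>C\<in>X. smult (of_nat (m C)) (monom 1 (m C) * (\<Prod>D\<in>X - {C}. qfac (m D))))"
proof -
  have d: "monom 1 1 * pderiv (qfac c) = smult (of_nat c) (monom 1 c)" for c
    by (cases c) (simp_all add: pderiv_diff pderiv_monom mult_monom smult_monom)
  have "monom 1 1 * pderiv (\<Prod>C\<in>X. qfac (m C)) =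
      (\<Sum>C\<in>X. (\<Prod>D\<in>X - {C}. qfac (m D)) * (monom 1 1 * pderiv (qfac (m C))))"
    unfolding pderiv_prod sum_distrib_left by (intro sum.cong) (simp_all add: mult_ac)
  then show ?thesis unfolding d by (simp add: mult_ac)
qed

lemma pairing_euler_prod:
  assumes "finite X"
  shows "(\<Sum>C\<in>X. of_nat (m C) * pairing g (monom 1 (m C) * (\<Prod>D\<in>X - {C}. qfac (m D))))
    = pairing (\<lambda>k. of_nat k * g k) (\<Prod>C\<in>X. qfac (m C))"
  unfolding pairing_pderiv[symmetric] euler_prod_qfac[OF assms]
  by (simp add: pairing_sum pairing_smult)

text \<open>The Euler operator of the variable that has been set to 1: \<open>y d/dy\<close> sends
  \<open>x^m - y^m\<close> to \<open>- m y^m\<close>, and on a product homogeneous of the total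
  degree it acts as that degree minus \<open>k\<close>. In one variable this follows from
  \<open>pairing_euler_prod\<close>, because removing the factor of \<open>C\<close> leaves a
  product \<open>P\<close> with \<open>r = q^(m C) P - P\<close>.\<close>

lemma pairing_coeuler_prod:
  assumes "finite X"
  shows "(\<Sum>C\<in>X. of_nat (m C) * pairing g (\<Prod>D\<in>X - {C}. qfac (m D)))
    = - pairing (\<lambda>k. (of_nat (\<Sum>C\<in>X. m C) - of_nat k) * g k) (\<Prod>C\<in>X. qfac (m C))"
proof -
  define r where "r = (\<Prod>C\<in>X. qfac (m C))"
  have rC: "r = monom 1 (m C) * (\<Prod>D\<in>X - {C}. qfac (m D)) - (\<Prod>D\<in>X - {C}. qfac (m D))" if "C \<in> X" for C
    unfolding r_def using that assms by (subst prod.remove[of X C]) (simp_all add: algebra_simps)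
  have "pairing g (\<Prod>D\<in>X - {C}. qfac (m D)) = pairing g (monom 1 (m C) * (\<Prod>D\<in>X - {C}. qfac (m D))) - pairing g r"
    if "C \<in> X" for C
    using arg_cong[where f = "pairing g", OF rC[OF that]] by (simp add: pairing_diff)
  then have "(\<Sum>C\<in>X. of_nat (m C) * pairing g (\<Prod>D\<in>X - {C}. qfac (m D)))
      = (\<Sum>C\<in>X. of_nat (m C) * (pairing g (monom 1 (m C) * (\<Prod>D\<in>X - {C}. qfac (m D))) - pairing g r))"
    by (intro sum.cong) simp_all
  also have "\<dots> = pairing (\<lambda>k. of_nat k * g k) r - of_nat (\<Sum>C\<in>X. m C) * pairing g r"
    unfolding right_diff_distrib sum_subtractf pairing_euler_prod[OF assms] r_def
    by (simp add: sum_distrib_right)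
  also have "\<dots> = - pairing (\<lambda>k. (of_nat (\<Sum>C\<in>X. m C) - of_nat k) * g k) r"
    using pairing_lincomb[of "of_nat (\<Sum>C\<in>X. m C)" g "-1" "\<lambda>k. of_nat k * g k" r]
    by (simp add: algebra_simps)
  finally show ?thesis unfolding r_def .
qed

text \<open>The weighted sum over \<open>C\<close> is a sum over the points that a transposition can
  join to a distinguished cycle with \<open>c\<close> counted points. Expanding
  \<open>q^(c + m C) - 1\<close> separates it into the two Euler operators, the first of them
  shifted by \<open>c\<close>.\<close>

lemma pairing_join_sum:
  assumes "finite X"
  shows "(\<Sum>C\<in>X. of_nat (m C) * pairing g (qfac (c + m C) * (\<Prod>D\<in>X - {C}. qfac (m D))))
    = pairing (\<lambda>k. of_nat k * g (k + c) + (of_nat (\<Sum>C\<in>X. m C) - of_nat k) * g k) (\<Prod>C\<in>X. qfac (m C))"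
proof -
  have e: "pairing g (qfac (c + m C) * (\<Prod>D\<in>X - {C}. qfac (m D)))
     = pairing (\<lambda>k. g (k + c)) (monom 1 (m C) * (\<Prod>D\<in>X - {C}. qfac (m D)))
       - pairing g (\<Prod>D\<in>X - {C}. qfac (m D))" for C
  proof -
    have "qfac (c + m C) * (\<Prod>D\<in>X - {C}. qfac (m D)) =
       monom 1 c * (monom 1 (m C) * (\<Prod>D\<in>X - {C}. qfac (m D))) - (\<Prod>D\<in>X - {C}. qfac (m D))"
      by (simp add: mult.assoc[symmetric] mult_monom left_diff_distrib)
    then show ?thesis by (simp only: pairing_diff pairing_monom_mult)
  qed
  show ?thesis
    unfolding e right_diff_distrib sum_subtractf pairing_euler_prod[OF assms] pairing_coeuler_prod[OF assms]
    using pairing_lincomb[of 1 _ 1] by simp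
qed

text \<open>The product of the two factors is \<open>q^c + 1 - q^d - q^(c-d)\<close>. The last two
  terms sum \<open>g\<close> over intervals of length \<open>c\<close>, which \<open>F\<close>
  telescopes; the interval for \<open>c - d\<close> starts at 1 instead of 0, and this is where the
  \<open>Suc\<close> in the kernel comes from.\<close>

lemma pairing_split_sum:
  assumes F: "\<And>k. F (Suc k) - F k = g k"
  shows "(\<Sum>d<c. pairing g (qfac d * (qfac (c - d) * r)))
    = pairing (\<lambda>k. of_nat c * (g (k + c) + g k) - (F (k + c) - F k) - (F (Suc (k + c)) - F (Suc k))) r"
proof -
  have tel: "(\<Sum>d<c. g (k + d)) = F (k + c) - F k" for c k
    by (induction c) (simp_all add: F[symmetric])
  have "(\<Sum>d<c. g (k + (c - d))) = (\<Sum>d<c. g (Suc k + d))" for k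
    by (subst sum.nat_diff_reindex[symmetric]) (intro sum.cong, auto)
  then have tel': "(\<Sum>d<c. g (k + (c - d))) = F (Suc (k + c)) - F (Suc k)" for k
    by (simp add: tel del: add_Suc) simp
  have e: "pairing g (qfac d * (qfac (c - d) * r)) = (\<Sum>k\<le>degree r. coeff r k * (g (k + c) + g k - g (k + d) - g (k + (c - d))))"
    if "d < c" for d
  proof -
    have "monom 1 d * (monom 1 (c - d) * r) = monom 1 c * r"
      using that by (simp add: mult.assoc[symmetric] mult_monom)
    then have "qfac d * (qfac (c - d) * r) = monom 1 c * r + r - monom 1 d * r - monom 1 (c - d) * r"
      by (simp add: algebra_simps)
    then have "pairing g (qfac d * (qfac (c - d) * r)) =
      pairing (\<lambda>k. g (k + c)) r + pairing g r - pairing (\<lambda>k. g (k + d)) r - pairing (\<lambda>k. g (k + (c - d))) r"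
      by (simp only: pairing_add pairing_diff pairing_monom_mult)
    then show ?thesis
      by (simp add: pairing_def sum.distrib[symmetric] sum_subtractf[symmetric] algebra_simps)
  qed
  have "(\<Sum>d<c. pairing g (qfac d * (qfac (c - d) * r)))
      = (\<Sum>d<c. \<Sum>k\<le>degree r. coeff r k * (g (k + c) + g k - g (k + d) - g (k + (c - d))))"
    by (intro sum.cong) (auto simp: e)
  also have "\<dots> = (\<Sum>k\<le>degree r. coeff r k * (\<Sum>d<c. (g (k + c) + g k - g (k + d) - g (k + (c - d)))))"
    by (subst sum.swap) (simp add: sum_distrib_left)
  also have "\<dots> = pairing (\<lambda>k. of_nat c * (g (k + c) + g k) - (F (k + c) - F k) - (F (Suc (k + c)) - F (Suc k))) r"
    unfolding pairing_def sum_subtractf tel tel' by simp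
  finally show ?thesis .
qed

lemma pairing_combine:
  "pairing g1 r + (pairing g2 r + z * (pairing g3 r - pairing g4 r))
    = pairing (\<lambda>k. g1 k + g2 k + z * (g3 k - g4 k)) r"
  by (simp add: pairing_def sum.distrib[symmetric] sum_subtractf[symmetric] sum_distrib_left algebra_simps)

text \<open>The kernel is determined by the recursion in \<open>phi_recursion\<close>; \<open>phi_anti\<close> is its antidifference.\<close>

definition phi :: "rat \<Rightarrow> nat \<Rightarrow> nat \<Rightarrow> rat" where
  "phi z m k = fact (m - 1) * ((z + of_nat k) gchoose (m + 1))"

definition phi_anti :: "rat \<Rightarrow> nat \<Rightarrow> nat \<Rightarrow> rat" where
  "phi_anti z m k = fact (m - 1) * ((z + of_nat k) gchoose (m + 2))"

text \<open>The second identity is the induction step at the level of kernels: joins, splits and the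
  split-off fixed point together amount to multiplication by \<open>q^(c+1) - 1\<close>, which is
  the factor of the whole cycle of \<open>s\<close>, now with \<open>s\<close> counted.\<close>

lemma phi_recursion:
  fixes z :: rat and N c k :: nat
  defines "F \<equiv> phi_anti z N"
  assumes "N > 0"
  shows "F (Suc k) - F k = phi z N k"
    and "of_nat k * phi z N (k + c) + (of_nat N - of_nat c - of_nat k) * phi z N k
      + (of_nat c * (phi z N (k + c) + phi z N k) - (F (k + c) - F k) - (F (Suc (k + c)) - F (Suc k)))
      + z * (phi z N (k + c) - phi z N k) = phi z (Suc N) (k + Suc c) - phi z (Suc N) k"
proof -
  have F_Suc: "F (Suc k) = F k + phi z N k" for k
    using gbinomial_Suc_Suc[of "z + of_nat k" "N + 1"]
    unfolding F_def phi_anti_def phi_def by (simp add: algebra_simps)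
  then show "F (Suc k) - F k = phi z N k" by simp
  have abs: "(of_nat N + 2) * F k = (z + of_nat k - of_nat N - 1) * phi z N k" for k
    using gbinomial_mult_1[of "z + of_nat k" "N + 1"]
    unfolding F_def phi_anti_def phi_def by (simp add: algebra_simps)
  have "(fact N :: rat) = of_nat N * fact (N - 1)" using assms(2) by (simp add: fact_reduce)
  \<comment> \<open>The antidifference at one level is, up to the factor \<open>N\<close>, the
    kernel of the next level; this makes the recursion close up.\<close>
  then have pS: "phi z (Suc N) k = of_nat N * F k" for k
    unfolding F_def phi_anti_def phi_def by simp
  have e1: "of_nat N * F k = (z + of_nat k - of_nat N - 1) * phi z N k - 2 * F k" for k
    using abs[of k] by (simp add: algebra_simps)
  show "of_nat k * phi z N (k + c) + (of_nat N - of_nat c - of_nat k) * phi z N k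
      + (of_nat c * (phi z N (k + c) + phi z N k) - (F (k + c) - F k) - (F (Suc (k + c)) - F (Suc k)))
      + z * (phi z N (k + c) - phi z N k) = phi z (Suc N) (k + Suc c) - phi z (Suc N) k"
  proof -
    have "phi z (Suc N) (k + Suc c) = of_nat N * F (k + c) + of_nat N * phi z N (k + c)"
      by (simp add: pS F_Suc algebra_simps)
    then show ?thesis unfolding pS F_Suc e1 by (simp add: algebra_simps)
  qed
qed

section \<open>Weights relative to the moved points, and their change under joins, splits and
  erasures\<close>

definition part_weight :: "rat \<Rightarrow> nat \<Rightarrow> rat poly" where
  "part_weight z c = (if c = 0 then [:z:] else qfac c)"

text \<open>As \<open>qfac 0\<close> vanishes, the exceptional value is an additive correction: sums
  over splits can be evaluated with \<open>qfac\<close> alone and corrected at their ends.\<close>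

lemma part_weight_alt: "part_weight z c = qfac c + (if c = 0 then [:z:] else 0)"
  by (simp add: part_weight_def monom_0 one_pCons)

text \<open>
  \<open>T\<close> is the set of points moved by the full cycles; a cycle disjoint from \<open>T\<close> survives as a cycle of
  every product and contributes the factor \<open>z\<close>.
\<close>

definition weight :: "rat \<Rightarrow> 'a set \<Rightarrow> 'a set \<Rightarrow> ('a \<Rightarrow> 'a) \<Rightarrow> rat poly" where
  "weight z S T p = (\<Prod>C\<in>cycles_on S p. part_weight z (card (C \<inter> T)))"

abbreviation other_cycles :: "'a set \<Rightarrow> ('a \<Rightarrow> 'a) \<Rightarrow> 'a \<Rightarrow> 'a set set" where
  "other_cycles S p s \<equiv> cycles_on S p - {orbit p s}"

lemma prod_part_weight_eq_qfac:
  assumes "p permutes S" "finite S" "X \<subseteq> cycles_on S p" "\<And>C. C \<in> X \<Longrightarrow> C \<inter> (S - T) = {}"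
  shows "(\<Prod>C\<in>X. part_weight z (card (C \<inter> T))) = (\<Prod>C\<in>X. qfac (card C))"
proof (intro prod.cong refl)
  fix C assume C: "C \<in> X"
  note D = cycles_onD[OF assms(1,2), of C]
  have "C \<inter> T = C" using C D(1) assms(3,4) by blast
  moreover have "card C \<noteq> 0" using C D(2,3) assms(3) by (meson card_0_eq subsetD)
  ultimately show "part_weight z (card (C \<inter> T)) = qfac (card C)" by (simp add: part_weight_def)
qed

text \<open>All points outside \<open>T\<close> lie in the two cycles being joined, so every other
  cycle enters with its full length.\<close>

lemma weight_join:
  assumes "p permutes S" "finite S" "b \<in> S" "s \<in> S" "b \<notin> orbit p s" "S - T \<subseteq> orbit p s \<union> orbit p b"
  shows "weight z S T (transpose b s \<circ> p) = part_weight z (card ((orbit p s \<union> orbit p b) \<inter> T))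
    * (\<Prod>C\<in>other_cycles S p s - {orbit p b}. qfac (card C))"
proof -
  define X where "X = other_cycles S p s - {orbit p b}"
  have os: "orbit p s \<in> cycles_on S p" "orbit p b \<in> cycles_on S p" using assms by (auto simp: cycles_on_def)
  have dis: "C \<inter> orbit p s = {} \<and> C \<inter> orbit p b = {}" if "C \<in> X" for C
    using that cycles_on_disjoint[OF assms(1,2) _ os(1), of C] cycles_on_disjoint[OF assms(1,2) _ os(2), of C]
    unfolding X_def by blast
  have "orbit p s \<union> orbit p b \<notin> X" using dis orbit_nonempty[of p s] by blast
  moreover have "cycles_on S (transpose b s \<circ> p) = insert (orbit p s \<union> orbit p b) X"
    unfolding cycles_on_transpose_comp_join[OF assms(1-5)] X_def by blast
  moreover have "finite X" unfolding X_def using assms(2) by simp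
  moreover have "(\<Prod>C\<in>X. part_weight z (card (C \<inter> T))) = (\<Prod>C\<in>X. qfac (card C))"
    using dis assms(6) unfolding X_def by (intro prod_part_weight_eq_qfac[OF assms(1,2)]) blast+
  ultimately show ?thesis unfolding weight_def X_def by simp
qed

lemma weight_split:
  assumes "p permutes S" "finite S" "s \<in> S" "0 < d" "d < card (orbit p s)" "S - T \<subseteq> orbit p s"
  obtains D where "weight z S T (transpose ((p ^^ d) s) s \<circ> p) =
      part_weight z (card (D \<inter> T)) * (part_weight z (card ((orbit p s - D) \<inter> T)) * (\<Prod>C\<in>other_cycles S p s. qfac (card C)))"
    "D \<subseteq> orbit p s" "card D = d" "s \<in> D" "(p ^^ d) s \<notin> D"
proof -
  obtain D where D: "cycles_on S (transpose ((p ^^ d) s) s \<circ> p) = insert D (insert (orbit p s - D) (other_cycles S p s))"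
    "D \<subseteq> orbit p s" "card D = d" "s \<in> D" "(p ^^ d) s \<notin> D"
    by (rule cycles_on_transpose_comp_split[OF assms(1-5)])
  have os: "orbit p s \<in> cycles_on S p" using assms by (auto simp: cycles_on_def)
  have dis: "C \<inter> orbit p s = {}" if "C \<in> other_cycles S p s" for C
    using that cycles_on_disjoint[OF assms(1,2) _ os(1), of C] by blast
  have ne: "C \<noteq> {}" if "C \<in> other_cycles S p s" for C
    using that cycles_onD(2)[OF assms(1,2)] by blast
  have "D \<notin> insert (orbit p s - D) (other_cycles S p s)" using D(2,4) dis by blast
  moreover have "orbit p s - D \<notin> other_cycles S p s" using dis ne by blast
  moreover have "(\<Prod>C\<in>other_cycles S p s. part_weight z (card (C \<inter> T))) = (\<Prod>C\<in>other_cycles S p s. qfac (card C))"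
    using dis assms(6) by (intro prod_part_weight_eq_qfac[OF assms(1,2)]) blast+
  ultimately have "weight z S T (transpose ((p ^^ d) s) s \<circ> p) =
      part_weight z (card (D \<inter> T)) * (part_weight z (card ((orbit p s - D) \<inter> T)) * (\<Prod>C\<in>other_cycles S p s. qfac (card C)))"
    unfolding weight_def D(1) using assms(2) by simp
  then show ?thesis using that D by blast
qed

text \<open>The counterpart of \<open>card_cycles_on_perm_delete\<close>: a point outside
  \<open>T\<close> enters no exponent and matters only when it is a cycle by itself, which accounts
  for one factor \<open>z\<close>.\<close>

lemma weight_delete:
  assumes "p permutes S" "finite S" "s \<in> S" "s \<notin> T"
  shows "weight z S T p = (if p s = s then [:z:] else 1) * weight z (S - {s}) T (perm_delete s p)"
proof -
  have os: "orbit p s \<in> cycles_on S p" using assms by (simp add: cycles_on_def)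
  have weight: "weight z S T p = part_weight z (card (orbit p s \<inter> T)) * (\<Prod>C\<in>other_cycles S p s. part_weight z (card (C \<inter> T)))"
    unfolding weight_def using assms(2) os by (intro prod.remove) simp_all
  show ?thesis
  proof (cases "p s = s")
    case True
    then have "orbit p s = {s}" by (simp add: orbit_eq_singleton_iff)
    then have "part_weight z (card (orbit p s \<inter> T)) = [:z:]" using assms(4) by (simp add: part_weight_def)
    then show ?thesis using True weight cycles_on_perm_delete[OF assms(1-3)] by (simp add: weight_def)
  next
    case False
    have "orbit p s - {s} \<notin> other_cycles S p s"
    proof
      assume A: "orbit p s - {s} \<in> other_cycles S p s"
      have "p s \<in> orbit p s - {s}" using False orbit.base[of p s] by simp
      moreover have "orbit p s \<inter> (orbit p s - {s}) = {}"
        using A by (intro cycles_on_disjoint[OF assms(1,2) os]) auto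
      ultimately show False by blast
    qed
    moreover have "(orbit p s - {s}) \<inter> T = orbit p s \<inter> T" using assms(4) by blast
    ultimately show ?thesis
      using False weight cycles_on_perm_delete[OF assms(1-3)] assms(2) by (simp add: weight_def)
  qed
qed

lemma sum_orbit:
  fixes H :: "'a \<Rightarrow> rat"
  assumes "p permutes S" "finite S"
  shows "(\<Sum>b\<in>orbit p s - {s}. H b) = (\<Sum>d\<in>{1..<card (orbit p s)}. H ((p ^^ d) s))"
proof -
  have "inj_on (\<lambda>d. (p ^^ d) s) {1..<card (orbit p s)}"
    by (rule inj_on_subset[OF orbit_card_funpow(2)[OF assms, of s]]) auto
  moreover have "(\<lambda>d. (p ^^ d) s) ` {1..<card (orbit p s)} = orbit p s - {s}"
  proof -
    have "{..<card (orbit p s)} = insert 0 {1..<card (orbit p s)}"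
      using orbit_card_funpow(4)[OF assms, of s] by auto
    then have "orbit p s = insert s ((\<lambda>d. (p ^^ d) s) ` {1..<card (orbit p s)})"
      using orbit_card_funpow(1)[OF assms, of s] by (metis (no_types, lifting) funpow_0 image_insert)
    moreover have "s \<notin> (\<lambda>d. (p ^^ d) s) ` {1..<card (orbit p s)}"
    proof
      assume "s \<in> (\<lambda>d. (p ^^ d) s) ` {1..<card (orbit p s)}"
      then obtain d where "1 \<le> d" "d < card (orbit p s)" "(p ^^ d) s = (p ^^ 0) s" by auto
      then show False using inj_onD[OF orbit_card_funpow(2)[OF assms, of s], of d 0] by auto
    qed
    ultimately show ?thesis by blast
  qed
  ultimately show ?thesis by (metis (no_types, lifting) sum.reindex_cong)
qed

lemma sum_other_cycles_join:
  fixes s :: 'a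
  assumes "p permutes S" "finite S" "s \<in> S"
  shows "(\<Sum>b\<in>S - orbit p s. pairing g (qfac (c + card (orbit p b)) * (\<Prod>C\<in>other_cycles S p s - {orbit p b}. qfac (card C))))
    = pairing (\<lambda>k. of_nat k * g (k + c) + (of_nat (card S) - of_nat (card (orbit p s)) - of_nat k) * g k)
        (\<Prod>C\<in>other_cycles S p s. qfac (card C))"
proof -
  have os: "orbit p s \<in> cycles_on S p" using assms by (auto simp: cycles_on_def)
  have U: "\<Union>(other_cycles S p s) = S - orbit p s"
    using Union_cycles_on[OF assms(1,2)] os cycles_on_disjoint[OF assms(1,2) _ os] by fastforce
  have "card (S - orbit p s) = card S - card (orbit p s)" "card (orbit p s) \<le> card S"
    using assms permutes_orbit_subset[OF assms(1,3)] by (auto intro!: card_Diff_subset card_mono finite_subset[of "orbit p s" S])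
  then have "of_nat (\<Sum>C\<in>other_cycles S p s. card C) = (of_nat (card S) - of_nat (card (orbit p s)) :: rat)"
    using card_Union_cycles_on[OF assms(1,2), of "other_cycles S p s"] U by (simp add: of_nat_diff Diff_subset flip: of_nat_sum)
  moreover have "(\<Sum>b\<in>S - orbit p s. pairing g (qfac (c + card (orbit p b)) * (\<Prod>C\<in>other_cycles S p s - {orbit p b}. qfac (card C))))
     = (\<Sum>D\<in>other_cycles S p s. of_nat (card D) * pairing g (qfac (c + card D) * (\<Prod>C\<in>other_cycles S p s - {D}. qfac (card C))))"
    unfolding U[symmetric] by (rule sum_over_cycles_on[OF assms(1,2)]) blast
  ultimately show ?thesis using pairing_join_sum[of "other_cycles S p s" card g c] assms(2) by simp
qed

section \<open>Averaging over full cycles\<close>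

text \<open>The correction comes from \<open>e = 0\<close>, where the transposition splits off the
  uncounted point \<open>s\<close> as a fixed point.\<close>

lemma part_weight_split_sum:
  "(\<Sum>e<c. pairing g (part_weight z e * (qfac (c - e) * r)))
   = (\<Sum>e<c. pairing g (qfac e * (qfac (c - e) * r))) + z * (pairing (\<lambda>k. g (k + c)) r - pairing g r)"
proof -
  have "pairing g (part_weight z e * (qfac (c - e) * r))
      = pairing g (qfac e * (qfac (c - e) * r)) + (if e = 0 then z * pairing g (qfac c * r) else 0)" for e
    unfolding part_weight_alt distrib_right pairing_add by (simp add: pairing_smult)
  moreover have "pairing g (qfac c * r) = pairing (\<lambda>k. g (k + c)) r - pairing g r"
    by (simp add: left_diff_distrib pairing_diff pairing_monom_mult)
  ultimately show ?thesis by (cases "c = 0") (simp_all add: sum.distrib pairing_monom_mult)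
qed

text \<open>With an uncounted point in each piece, both ends \<open>e = 0\<close> and
  \<open>e = c\<close> contribute a factor \<open>z\<close>. For \<open>c = 0\<close> the two ends
  would coincide and give \<open>z^2\<close>; excluding this is where parts of size at least 3
  enter.\<close>

lemma part_weight_split_sum2:
  assumes "c > 0"
  shows "(\<Sum>e<Suc c. pairing g (part_weight z e * (part_weight z (c - e) * r)))
   = (\<Sum>e<c. pairing g (qfac e * (qfac (c - e) * r))) + 2 * z * (pairing (\<lambda>k. g (k + c)) r - pairing g r)"
proof -
  have q: "pairing g (qfac c * r) = pairing (\<lambda>k. g (k + c)) r - pairing g r"
    by (simp add: left_diff_distrib pairing_diff pairing_monom_mult)
  have "(\<Sum>e<Suc c. pairing g (part_weight z e * (part_weight z (c - e) * r)))
    = (\<Sum>e<c. pairing g (part_weight z e * (qfac (c - e) * r))) + pairing g (part_weight z c * (part_weight z 0 * r))"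
    by (simp add: part_weight_def)
  also have "part_weight z c * (part_weight z 0 * r) = [:z:] * (qfac c * r)" using assms by (simp add: part_weight_def)
  finally show ?thesis unfolding pairing_mult_const part_weight_split_sum q by (simp add: algebra_simps)
qed

text \<open>Two kinds of step alternate: if \<open>T = S\<close>, a point leaves \<open>T\<close> by
  factoring the full cycle; if \<open>T\<close> is smaller, a point outside \<open>T\<close> is
  erased from \<open>S\<close>. Each lowers \<open>card S + card T\<close> by one.\<close>

theorem sum_full_cycles_pairing:
  assumes "finite S" "T \<subseteq> S" "T \<noteq> {}" "p permutes S"
  shows "(\<Sum>\<zeta>\<in>full_cycles T. z ^ card (cycles_on S (\<zeta> \<circ> p))) = pairing (phi z (card T)) (weight z S T p)"
  using assms
proof (induction "card S + card T" arbitrary: S T p rule: less_induct)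
  case less
  note fin = less.prems(1) and pS = less.prems(4)
  consider s where "s \<in> S - T" | s where "S = {s}" "T = S" | s where "s \<in> S" "S \<noteq> {s}" "T = S"
    using less.prems by blast
  then show ?case
  proof cases
    case 1
    let ?q = "perm_delete s p"
    have s: "s \<in> S" "s \<notin> T" using 1 by auto
    have e: "z ^ card (cycles_on S (\<zeta> \<circ> p)) = (if p s = s then z else 1) * z ^ card (cycles_on (S - {s}) (\<zeta> \<circ> ?q))"
      if "\<zeta> \<in> full_cycles T" for \<zeta>
    proof -
      have \<zeta>T: "\<zeta> permutes T" using that by (simp add: full_cycles_def)
      then have \<zeta>: "\<zeta> permutes S" using less.prems(2) by (rule permutes_subset)
      have fs: "\<zeta> s = s" using \<zeta>T s by (simp add: permutes_not_in)
      have inj: "inj \<zeta>" by (rule permutes_inj[OF \<zeta>])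
      have "(\<zeta> \<circ> p) s = s \<longleftrightarrow> p s = s" using inj_eq[OF inj, of "p s" s] fs by simp
      then show ?thesis
        using card_cycles_on_perm_delete[OF permutes_compose[OF pS \<zeta>] fin s(1)]
        unfolding perm_delete_comp[OF fs inj] by simp
    qed
    have "card (S - {s}) + card T < card S + card T"
      using card_Diff1_less[OF fin s(1)] by simp
    then have "(\<Sum>\<zeta>\<in>full_cycles T. z ^ card (cycles_on (S - {s}) (\<zeta> \<circ> ?q))) = pairing (phi z (card T)) (weight z (S - {s}) T ?q)"
      using less.prems s perm_delete_permutes[OF pS s(1)] by (intro less.hyps) auto
    then show ?thesis
      using weight_delete[OF pS fin s, of z]
      by (simp add: e sum_distrib_left[symmetric] pairing_smult)
  next
    case 2
    have "p = id" using pS 2 by (metis permutes_sing)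
    moreover have "orbit id s = {s}" by (simp add: orbit_eq_singleton_iff)
    ultimately show ?thesis
      using 2 by (simp add: full_cycles_singleton cycles_on_def weight_def part_weight_def pairing_diff pairing_monom_mult[of _ 1 1, simplified]
         phi_def numeral_2_eq_2 gbinomial_Suc field_simps)
  next
    case 3
    define N where "N = card (S - {s})"
    \<comment> \<open>The cycle of \<open>s\<close> is counted without \<open>s\<close>, which is
      not in the smaller set \<open>S - {s}\<close>.\<close>
    define c where "c = card (orbit p s) - 1"
    define r where "r = (\<Prod>C\<in>other_cycles S p s. qfac (card C))"
    define W where "W b = weight z S (S - {s}) (transpose b s \<circ> p)" for b
    have s: "s \<in> S" by (rule 3(1))
    have cardS: "card S = Suc N" unfolding N_def by (rule card.remove[OF fin s])
    have "S - {s} \<noteq> {}" using 3(2) s by blast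
    then have "N > 0" using fin unfolding N_def by (simp add: card_gt_0_iff del: card_Diff_insert Diff_eq_empty_iff)
    have cs: "card (orbit p s) = Suc c"
      using orbit_card_funpow(4)[OF pS fin, of s] by (simp add: c_def)
    have self: "x \<in> orbit p x" for x by (rule mem_orbit_self[OF pS fin])
    have sub: "orbit p s \<subseteq> S" by (rule permutes_orbit_subset[OF pS s])
    have fino: "finite (orbit p x)" if "x \<in> S" for x
      using permutes_orbit_subset[OF pS that] fin by (rule finite_subset)
    have "(\<Sum>\<zeta>\<in>full_cycles T. z ^ card (cycles_on S (\<zeta> \<circ> p)))
        = (\<Sum>b\<in>S - {s}. \<Sum>\<zeta>\<in>full_cycles (S - {s}). z ^ card (cycles_on S (\<zeta> \<circ> (transpose b s \<circ> p))))"
      using sum_full_cycles[OF fin s 3(2), of "\<lambda>\<zeta>. z ^ card (cycles_on S (\<zeta> \<circ> p))"] 3(3)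
      by (simp add: comp_assoc)
    also have "\<dots> = (\<Sum>b\<in>S - {s}. pairing (phi z N) (W b))"
    proof (intro sum.cong refl)
      fix b assume b: "b \<in> S - {s}"
      show "(\<Sum>\<zeta>\<in>full_cycles (S - {s}). z ^ card (cycles_on S (\<zeta> \<circ> (transpose b s \<circ> p)))) = pairing (phi z N) (W b)"
        unfolding W_def N_def
      proof (rule less.hyps)
        show "card S + card (S - {s}) < card S + card T"
          using 3 card_Diff1_less[OF fin s] by simp
        show "(transpose b s \<circ> p) permutes S" using b by (intro permutes_transpose_comp[OF pS _ s]) simp
      qed (use b fin in auto)
    qed
    also have "\<dots> = (\<Sum>b\<in>S - orbit p s. pairing (phi z N) (W b)) + (\<Sum>b\<in>orbit p s - {s}. pairing (phi z N) (W b))"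
    proof -
      have "S - {s} = (S - orbit p s) \<union> (orbit p s - {s})" using sub self[of s] by blast
      then show ?thesis using fin fino[OF s] by (simp add: sum.union_disjoint[symmetric] Int_commute disjoint_iff)
    qed
    also have "(\<Sum>b\<in>S - orbit p s. pairing (phi z N) (W b))
        = (\<Sum>b\<in>S - orbit p s. pairing (phi z N) (qfac (c + card (orbit p b)) * (\<Prod>C\<in>other_cycles S p s - {orbit p b}. qfac (card C))))"
    proof (intro sum.cong refl)
      fix b assume b: "b \<in> S - orbit p s"
      have "orbit p s \<inter> orbit p b = {}"
      proof (rule cycles_on_disjoint[OF pS fin])
        show "orbit p s \<noteq> orbit p b" using b self[of b] by auto
      qed (use b s in \<open>auto simp: cycles_on_def\<close>)
      then have "card (orbit p s \<union> orbit p b) = Suc c + card (orbit p b)"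
        using fino s b cs by (subst card_Un_disjoint) auto
      moreover have "(orbit p s \<union> orbit p b) \<inter> (S - {s}) = orbit p s \<union> orbit p b - {s}"
        using sub permutes_orbit_subset[OF pS, of b] b by auto
      ultimately have cd: "card ((orbit p s \<union> orbit p b) \<inter> (S - {s})) = c + card (orbit p b)"
        using self[of s] by simp
      have "card (orbit p b) \<noteq> 0" using orbit_card_funpow(4)[OF pS fin, of b] by simp
      then have part_weight: "part_weight z (c + card (orbit p b)) = qfac (c + card (orbit p b))" by (simp add: part_weight_def)
      have "W b = qfac (c + card (orbit p b)) * (\<Prod>C\<in>other_cycles S p s - {orbit p b}. qfac (card C))"
        unfolding W_def using weight_join[OF pS fin _ s, of b "S - {s}" z] b self[of s] cd part_weight by auto
      then show "pairing (phi z N) (W b) = pairing (phi z N) (qfac (c + card (orbit p b)) * (\<Prod>C\<in>other_cycles S p s - {orbit p b}. qfac (card C)))"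
        by simp
    qed
    also have "\<dots> = pairing (\<lambda>k. of_nat k * phi z N (k + c) + (of_nat N - of_nat c - of_nat k) * phi z N k) r"
      unfolding sum_other_cycles_join[OF pS fin s] r_def by (simp add: cardS cs)
    also have "(\<Sum>b\<in>orbit p s - {s}. pairing (phi z N) (W b))
        = (\<Sum>e<c. pairing (phi z N) (part_weight z e * (qfac (c - e) * r)))"
    proof -
      \<comment> \<open>Taking \<open>b\<close> as the iterate with exponent \<open>e + 1\<close>
        gives a piece with \<open>e + 1\<close> points; one of them is \<open>s\<close>, so
        \<open>e\<close> of them are counted.\<close>
      have "(\<Sum>b\<in>orbit p s - {s}. pairing (phi z N) (W b)) = (\<Sum>e<c. pairing (phi z N) (W ((p ^^ Suc e) s)))"
        unfolding sum_orbit[OF pS fin] cs by (rule sum.reindex_bij_witness[of _ Suc "\<lambda>d. d - 1"]) auto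
      also have "\<dots> = (\<Sum>e<c. pairing (phi z N) (part_weight z e * (qfac (c - e) * r)))"
      proof (intro sum.cong refl)
        fix e assume e: "e \<in> {..<c}"
        have sub': "S - (S - {s}) \<subseteq> orbit p s" using self[of s] by auto
        have le: "Suc e < card (orbit p s)" using e cs by simp
        obtain D where D: "W ((p ^^ Suc e) s) =
            part_weight z (card (D \<inter> (S - {s}))) * (part_weight z (card ((orbit p s - D) \<inter> (S - {s}))) * r)"
            "D \<subseteq> orbit p s" "card D = Suc e" "s \<in> D"
          using weight_split[OF pS fin s zero_less_Suc le sub', of z] unfolding W_def r_def by blast
        have "D \<inter> (S - {s}) = D - {s}" "(orbit p s - D) \<inter> (S - {s}) = orbit p s - D" using D sub by auto
        moreover have "card (D - {s}) = e" "card (orbit p s - D) = c - e"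
          using D cs fino[OF s] by (auto simp: card_Diff_subset finite_subset)
        ultimately show "pairing (phi z N) (W ((p ^^ Suc e) s)) = pairing (phi z N) (part_weight z e * (qfac (c - e) * r))"
          using D(1) e by (simp add: part_weight_def)
      qed
      finally show ?thesis .
    qed
    also note part_weight_split_sum
    also note pairing_split_sum[of "phi_anti z N" "phi z N", OF phi_recursion(1)[OF \<open>N > 0\<close>]]
    finally have "(\<Sum>\<zeta>\<in>full_cycles T. z ^ card (cycles_on S (\<zeta> \<circ> p)))
       = pairing (\<lambda>k. phi z (Suc N) (k + Suc c) - phi z (Suc N) k) r"
      unfolding pairing_combine phi_recursion(2)[OF \<open>N > 0\<close>] .
    also have "\<dots> = pairing (phi z (Suc N)) (qfac (Suc c) * r)"
      unfolding left_diff_distrib pairing_diff pairing_monom_mult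
      using pairing_lincomb[of 1 "\<lambda>k. phi z (Suc N) (k + Suc c)" "-1"] by simp
    also have "qfac (Suc c) * r = weight z S T p"
    proof -
      have "weight z S T p = (\<Prod>C\<in>cycles_on S p. qfac (card C))"
        unfolding weight_def 3(3) by (rule prod_part_weight_eq_qfac[OF pS fin]) auto
      also have "\<dots> = qfac (Suc c) * r"
        unfolding r_def cs[symmetric] using fin s by (intro prod.remove) (auto simp: cycles_on_def)
      finally show ?thesis by simp
    qed
    finally show ?thesis by (simp only: 3(3) cardS)
  qed
qed

section \<open>Averaging over permutations with a 2-cycle and one other cycle\<close>

text \<open>
  The homogeneous degree is \<open>n\<close>, so \<open>of_nat k\<close> and \<open>of_nat n - of_nat k\<close> in \<open>psi\<close> are the Euler operators
  of the two variables.
\<close>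

definition psi_in :: "rat \<Rightarrow> nat \<Rightarrow> nat \<Rightarrow> rat" where
  "psi_in z n k = (of_nat k - 1 + 2 * z) * ((z + of_nat k - 2) gchoose (n - 1)) - 2 * ((z + of_nat k - 1) gchoose n)"

definition psi_out :: "rat \<Rightarrow> nat \<Rightarrow> nat \<Rightarrow> rat" where
  "psi_out z n k = (2 * z - (of_nat n - of_nat k - 1)) * ((z + of_nat k) gchoose (n - 1)) - 2 * ((z + of_nat k) gchoose n)"

definition psi :: "rat \<Rightarrow> nat \<Rightarrow> nat \<Rightarrow> rat" where
  "psi z n k = of_nat k * psi_in z n k + (of_nat n - of_nat k) * psi_out z n k"

text \<open>This is the origin of \<open>psi_in\<close> and \<open>psi_out\<close>: up to sign and
  \<open>(n - 3)!\<close> they collect the terms taken near \<open>k + c\<close> and near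
  \<open>k\<close>. The argument of \<open>psi_in\<close> is shifted by the full cycle length
  \<open>c + 2\<close>, while the terms collected stand at \<open>k + c\<close> and
  \<open>Suc (k + c)\<close>; hence \<open>z + k - 2\<close> and \<open>z + k - 1\<close> in its
  binomial coefficients.\<close>

lemma psi_local:
  fixes z :: rat and n c k :: nat
  defines "N \<equiv> n - 2" and "F \<equiv> phi_anti z (n - 2)"
  assumes "n \<ge> 3"
  shows "of_nat k * phi z N (k + c) + (of_nat n - of_nat (c + 2) - of_nat k) * phi z N k
      + (of_nat c * (phi z N (k + c) + phi z N k) - (F (k + c) - F k) - (F (Suc (k + c)) - F (Suc k)))
      + 2 * z * (phi z N (k + c) - phi z N k)
    = fact (n - 3) * (psi_in z n (k + (c + 2)) - psi_out z n k)"
proof -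
  have N: "N > 0" "n - 2 - 1 = n - 3" "N + 1 = n - 1" "n - 2 + 2 = n" "N - 1 = n - 3" using assms by auto
  have F_Suc: "F (Suc k) = F k + phi z N k" for k
    using phi_recursion(1)[OF N(1), of z k] unfolding F_def N_def by simp
  have ph: "fact (n - 3) * ((z + of_nat k) gchoose (n - 1)) = phi z N k" for k
    by (simp only: phi_def N)
  have F: "fact (n - 3) * ((z + of_nat k) gchoose n) = F k" for k
    by (simp only: F_def phi_anti_def N)
  have "fact (n - 3) * psi_in z n (k + (c + 2)) = (of_nat (k + c) + 1 + 2 * z) * phi z N (k + c) - 2 * F (Suc (k + c))"
    unfolding psi_in_def ph[symmetric] F[symmetric] by (simp add: algebra_simps)
  moreover have "fact (n - 3) * psi_out z n k = (2 * z - (of_nat n - of_nat k - 1)) * phi z N k - 2 * F k"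
    unfolding psi_out_def ph[symmetric] F[symmetric] by (simp add: algebra_simps)
  ultimately show ?thesis unfolding right_diff_distrib F_Suc by (simp add: algebra_simps)
qed

text \<open>Now both \<open>a\<close> and \<open>b\<close> are uncounted. A joined cycle contains
  both of them; after a split each piece contains exactly one, leaving \<open>e\<close> and
  \<open>c - e\<close> counted points with \<open>e\<close> running from 0 up to and including
  \<open>c\<close>.\<close>

lemma sum_second_point:
  assumes "finite S" "p permutes S" "a \<in> S" "card (orbit p a) \<ge> 3"
  shows "(\<Sum>b\<in>S - {a}. \<Sum>\<zeta>\<in>full_cycles (S - {a, b}). z ^ card (cycles_on S (\<zeta> \<circ> (transpose b a \<circ> p))))
    = fact (card S - 3) * (pairing (psi_in z (card S)) (monom 1 (card (orbit p a)) * (\<Prod>C\<in>other_cycles S p a. qfac (card C)))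
        - pairing (psi_out z (card S)) (\<Prod>C\<in>other_cycles S p a. qfac (card C)))"
proof -
  define n where "n = card S"
  define c where "c = card (orbit p a) - 2"
  define r where "r = (\<Prod>C\<in>other_cycles S p a. qfac (card C))"
  define W where "W b = weight z S (S - {a, b}) (transpose b a \<circ> p)" for b
  note fin = assms(1) and pS = assms(2) and a = assms(3)
  have cs: "card (orbit p a) = c + 2" "c > 0" using assms(4) by (auto simp: c_def)
  have self: "x \<in> orbit p x" for x by (rule mem_orbit_self[OF pS fin])
  have sub: "orbit p x \<subseteq> S" if "x \<in> S" for x by (rule permutes_orbit_subset[OF pS that])
  have fino: "finite (orbit p x)" if "x \<in> S" for x using sub[OF that] fin by (rule finite_subset)
  have n3: "n \<ge> 3" using card_mono[OF fin sub[OF a]] assms(4) unfolding n_def by simp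
  have "(\<Sum>b\<in>S - {a}. \<Sum>\<zeta>\<in>full_cycles (S - {a, b}). z ^ card (cycles_on S (\<zeta> \<circ> (transpose b a \<circ> p))))
     = (\<Sum>b\<in>S - {a}. pairing (phi z (n - 2)) (W b))"
  proof (intro sum.cong refl)
    fix b assume b: "b \<in> S - {a}"
    have cd: "card (S - {a, b}) = n - 2"
      unfolding n_def using a b fin by (subst card_Diff_subset) auto
    then have "S - {a, b} \<noteq> {}" using n3 by (metis card.empty diff_is_0_eq not_less_eq_eq numeral_2_eq_2 numeral_3_eq_3)
    then show "(\<Sum>\<zeta>\<in>full_cycles (S - {a, b}). z ^ card (cycles_on S (\<zeta> \<circ> (transpose b a \<circ> p)))) = pairing (phi z (n - 2)) (W b)"
      unfolding W_def cd[symmetric] using b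
      by (intro sum_full_cycles_pairing[OF fin] permutes_transpose_comp[OF pS _ a]) auto
  qed
  also have "\<dots> = (\<Sum>b\<in>S - orbit p a. pairing (phi z (n - 2)) (W b)) + (\<Sum>b\<in>orbit p a - {a}. pairing (phi z (n - 2)) (W b))"
  proof -
    have "S - {a} = (S - orbit p a) \<union> (orbit p a - {a})" using sub[OF a] self[of a] by blast
    then show ?thesis using fin fino[OF a] by (simp add: sum.union_disjoint[symmetric] Int_commute disjoint_iff)
  qed
  also have "(\<Sum>b\<in>S - orbit p a. pairing (phi z (n - 2)) (W b))
      = (\<Sum>b\<in>S - orbit p a. pairing (phi z (n - 2)) (qfac (c + card (orbit p b)) * (\<Prod>C\<in>other_cycles S p a - {orbit p b}. qfac (card C))))"
  proof (intro sum.cong refl)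
    fix b assume b: "b \<in> S - orbit p a"
    have "orbit p a \<inter> orbit p b = {}"
    proof (rule cycles_on_disjoint[OF pS fin])
      show "orbit p a \<noteq> orbit p b" using b self[of b] by auto
    qed (use b a in \<open>auto simp: cycles_on_def\<close>)
    then have "card (orbit p a \<union> orbit p b) = c + 2 + card (orbit p b)"
      using fino a b cs by (subst card_Un_disjoint) auto
    moreover have "(orbit p a \<union> orbit p b) \<inter> (S - {a, b}) = orbit p a \<union> orbit p b - {a, b}"
      using sub[OF a] sub[of b] b by auto
    moreover have "card (orbit p a \<union> orbit p b - {a, b}) = card (orbit p a \<union> orbit p b) - card {a, b}"
      using self[of a] self[of b] by (intro card_Diff_subset) auto
    moreover have "a \<noteq> b" using b self[of a] by blast
    then have "card {a, b} = 2" by simp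
    ultimately have cd: "card ((orbit p a \<union> orbit p b) \<inter> (S - {a, b})) = c + card (orbit p b)" by simp
    have part_weight: "part_weight z (c + card (orbit p b)) = qfac (c + card (orbit p b))" using cs by (simp add: part_weight_def)
    have "W b = qfac (c + card (orbit p b)) * (\<Prod>C\<in>other_cycles S p a - {orbit p b}. qfac (card C))"
      unfolding W_def using weight_join[OF pS fin _ a, of b "S - {a, b}" z] b self[of a] self[of b] cd part_weight by auto
    then show "pairing (phi z (n - 2)) (W b) = pairing (phi z (n - 2)) (qfac (c + card (orbit p b)) * (\<Prod>C\<in>other_cycles S p a - {orbit p b}. qfac (card C)))"
      by simp
  qed
  also have "\<dots> = pairing (\<lambda>k. of_nat k * phi z (n - 2) (k + c) + (of_nat n - of_nat (c + 2) - of_nat k) * phi z (n - 2) k) r"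
    unfolding sum_other_cycles_join[OF pS fin a] r_def by (simp only: n_def[symmetric] cs)
  also have "(\<Sum>b\<in>orbit p a - {a}. pairing (phi z (n - 2)) (W b))
      = (\<Sum>e<Suc c. pairing (phi z (n - 2)) (part_weight z e * (part_weight z (c - e) * r)))"
  proof -
    have "(\<Sum>b\<in>orbit p a - {a}. pairing (phi z (n - 2)) (W b)) = (\<Sum>e<Suc c. pairing (phi z (n - 2)) (W ((p ^^ Suc e) a)))"
      unfolding sum_orbit[OF pS fin] cs by (rule sum.reindex_bij_witness[of _ Suc "\<lambda>d. d - 1"]) auto
    also have "\<dots> = (\<Sum>e<Suc c. pairing (phi z (n - 2)) (part_weight z e * (part_weight z (c - e) * r)))"
    proof (intro sum.cong refl)
      fix e assume e: "e \<in> {..<Suc c}"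
      define b where "b = (p ^^ Suc e) a"
      have bo: "b \<in> orbit p a" unfolding b_def by (rule funpow_in_orbit[OF self])
      then have sub': "S - (S - {a, b}) \<subseteq> orbit p a" using self[of a] by auto
      have le: "Suc e < card (orbit p a)" using e cs by simp
      obtain D where D: "W b =
          part_weight z (card (D \<inter> (S - {a, b}))) * (part_weight z (card ((orbit p a - D) \<inter> (S - {a, b}))) * r)"
          "D \<subseteq> orbit p a" "card D = Suc e" "a \<in> D" "b \<notin> D"
        using weight_split[OF pS fin a zero_less_Suc le sub', of z] unfolding W_def r_def b_def by blast
      have finD: "finite D" using D(2) fino[OF a] by (rule finite_subset)
      have "D \<inter> (S - {a, b}) = D - {a}" "(orbit p a - D) \<inter> (S - {a, b}) = orbit p a - D - {b}"
        using D sub[OF a] by auto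
      moreover have "card (D - {a}) = e" using D by simp
      moreover have "card (orbit p a - D) = c + 1 - e"
        using D(2,3) cs finD by (simp add: card_Diff_subset)
      then have "card (orbit p a - D - {b}) = c - e" using bo D(5) by simp
      ultimately show "pairing (phi z (n - 2)) (W ((p ^^ Suc e) a)) = pairing (phi z (n - 2)) (part_weight z e * (part_weight z (c - e) * r))"
        using D(1) unfolding b_def by simp
    qed
    finally show ?thesis .
  qed
  also note part_weight_split_sum2[OF cs(2)]
  also have "(\<Sum>e<c. pairing (phi z (n - 2)) (qfac e * (qfac (c - e) * r)))
    = pairing (\<lambda>k. of_nat c * (phi z (n - 2) (k + c) + phi z (n - 2) k)
        - (phi_anti z (n - 2) (k + c) - phi_anti z (n - 2) k)
        - (phi_anti z (n - 2) (Suc (k + c)) - phi_anti z (n - 2) (Suc k))) r"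
    using n3 by (intro pairing_split_sum phi_recursion(1)) simp
  finally have "(\<Sum>b\<in>S - {a}. \<Sum>\<zeta>\<in>full_cycles (S - {a, b}). z ^ card (cycles_on S (\<zeta> \<circ> (transpose b a \<circ> p))))
     = pairing (\<lambda>k. fact (n - 3) * (psi_in z n (k + (c + 2)) - psi_out z n k)) r"
    unfolding pairing_combine psi_local[OF n3] .
  also have "\<dots> = fact (n - 3) * (pairing (psi_in z n) (monom 1 (c + 2) * r) - pairing (psi_out z n) r)"
    unfolding pairing_monom_mult right_diff_distrib
    using pairing_lincomb[of "fact (n - 3)" "\<lambda>k. psi_in z n (k + (c + 2))" "- fact (n - 3)"] by simp
  finally show ?thesis unfolding r_def cs n_def .
qed

text \<open>Summing over \<open>a\<close> weights each cycle by its length, so the two parts of the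
  kernel for fixed \<open>a\<close> acquire the two Euler factors \<open>k\<close> and
  \<open>n - k\<close>, which is the shape of \<open>psi\<close>.\<close>

theorem sum_two_points_pairing:
  assumes "finite S" "p permutes S" "\<And>C. C \<in> cycles_on S p \<Longrightarrow> card C \<ge> 3"
  shows "(\<Sum>a\<in>S. \<Sum>b\<in>S - {a}. \<Sum>\<zeta>\<in>full_cycles (S - {a, b}). z ^ card (cycles_on S (\<zeta> \<circ> (transpose b a \<circ> p))))
    = fact (card S - 3) * pairing (psi z (card S)) (\<Prod>C\<in>cycles_on S p. qfac (card C))"
proof -
  define X where "X = cycles_on S p"
  define n where "n = card S"
  have finX: "finite X" using assms(1) by (simp add: X_def)
  have U: "\<Union>X = S" unfolding X_def by (rule Union_cycles_on[OF assms(2,1)])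
  define G where "G C = pairing (psi_in z n) (monom 1 (card C) * (\<Prod>D\<in>X - {C}. qfac (card D)))
        - pairing (psi_out z n) (\<Prod>D\<in>X - {C}. qfac (card D))" for C
  have "(\<Sum>a\<in>S. \<Sum>b\<in>S - {a}. \<Sum>\<zeta>\<in>full_cycles (S - {a, b}). z ^ card (cycles_on S (\<zeta> \<circ> (transpose b a \<circ> p))))
     = (\<Sum>a\<in>S. fact (n - 3) * G (orbit p a))"
  proof (intro sum.cong refl)
    fix a assume "a \<in> S"
    then have "orbit p a \<in> cycles_on S p" by (simp add: cycles_on_def)
    then show "(\<Sum>b\<in>S - {a}. \<Sum>\<zeta>\<in>full_cycles (S - {a, b}). z ^ card (cycles_on S (\<zeta> \<circ> (transpose b a \<circ> p)))) = fact (n - 3) * G (orbit p a)"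
      unfolding G_def X_def n_def by (intro sum_second_point[OF assms(1,2) \<open>a \<in> S\<close>] assms(3))
  qed
  also have "\<dots> = fact (n - 3) * (\<Sum>a\<in>\<Union>X. G (orbit p a))" by (simp add: sum_distrib_left U)
  also have "(\<Sum>a\<in>\<Union>X. G (orbit p a)) = (\<Sum>C\<in>X. of_nat (card C) * G C)"
    unfolding X_def by (rule sum_over_cycles_on[OF assms(2,1)]) simp
  also have "\<dots> = pairing (\<lambda>k. of_nat k * psi_in z n k) (\<Prod>C\<in>X. qfac (card C))
      + pairing (\<lambda>k. (of_nat n - of_nat k) * psi_out z n k) (\<Prod>C\<in>X. qfac (card C))"
  proof -
    have "n = (\<Sum>C\<in>X. card C)"
      using card_Union_cycles_on[OF assms(2,1), of X] U unfolding n_def X_def by simp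
    then show ?thesis
      unfolding G_def right_diff_distrib sum_subtractf pairing_euler_prod[OF finX] pairing_coeuler_prod[OF finX]
      by simp
  qed
  also have "\<dots> = pairing (psi z n) (\<Prod>C\<in>X. qfac (card C))"
    using pairing_lincomb[of 1 "\<lambda>k. of_nat k * psi_in z n k" 1] by (simp add: psi_def[abs_def])
  finally show ?thesis unfolding X_def n_def .
qed

section \<open>Evaluation of the functional on the basis\<close>

lemma gbinomial_Suc_mult: "of_nat (Suc k) * (a gchoose Suc k) = (a - of_nat k) * (a gchoose k)" for a :: rat
  using gbinomial_mult_1[of a k] by (simp add: algebra_simps)

text \<open>Pascal's rule brings all upper arguments down to \<open>y = z + k - 2\<close>, after
  which a polynomial identity remains. Three applications to \<open>(y + 3) gchoose (m + 3)\<close>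
  reach the lower index \<open>n - 3\<close>, so \<open>n = 1\<close> and \<open>n = 2\<close> are
  computed separately.\<close>

lemma psi_step:
  assumes "n \<ge> 1"
  shows "psi z (Suc n) (Suc k) - psi z (Suc n) k = psi z n k"
proof -
  define y where "y = z + of_nat k - 2"
  consider "n = 1" | "n = 2" | m where "n = m + 3"
    using assms by (metis One_nat_def Suc_1 add.commute le_Suc_ex less_one linorder_not_less not_less_eq_eq numeral_3_eq_3 le_antisym)
  then show ?thesis
  proof cases
    case 1
    then show ?thesis
      unfolding psi_def psi_in_def psi_out_def
      by (simp add: numeral_2_eq_2 gbinomial_Suc field_simps)
  next
    case 2
    then show ?thesis
      unfolding psi_def psi_in_def psi_out_def
      by (simp add: numeral_2_eq_2 gbinomial_Suc field_simps)
  next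
    case 3
    define M where "M = (of_nat m :: rat)"
    define K where "K = (of_nat k :: rat)"
    \<comment> \<open>Dividing by these four factors makes each binomial coefficient at
      \<open>y\<close> with lower index \<open>m\<close> to \<open>m + 4\<close> a polynomial
      multiple of \<open>d\<close>, without fractions.\<close>
    define d where "d = (y gchoose m) / ((M + 1) * (M + 2) * (M + 3) * (M + 4))"
    have M0: "M + 1 \<noteq> 0" "M + 2 \<noteq> 0" "M + 3 \<noteq> 0" "M + 4 \<noteq> 0"
      unfolding M_def by (simp_all add: add_eq_0_iff_both_eq_0)
    have c0: "y gchoose m = (M + 1) * (M + 2) * (M + 3) * (M + 4) * d"
      using M0 by (simp add: d_def)
    have "(M + 1) * (y gchoose (m + 1)) = (y - M) * (y gchoose m)"
      using gbinomial_Suc_mult[of m y] by (simp add: M_def add.commute)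
    then have "(M + 1) * (y gchoose (m + 1)) = (M + 1) * ((y - M) * (M + 2) * (M + 3) * (M + 4) * d)" by (simp only: c0 mult_ac)
    then have c1: "y gchoose (m + 1) = (y - M) * (M + 2) * (M + 3) * (M + 4) * d" using M0 by simp
    have "(M + 2) * (y gchoose (m + 2)) = (y - M - 1) * (y gchoose (m + 1))"
      using gbinomial_Suc_mult[of "m + 1" y] by (simp add: M_def algebra_simps)
    then have "(M + 2) * (y gchoose (m + 2)) = (M + 2) * ((y - M - 1) * (y - M) * (M + 3) * (M + 4) * d)" by (simp only: c1 mult_ac)
    then have c2: "y gchoose (m + 2) = (y - M - 1) * (y - M) * (M + 3) * (M + 4) * d" using M0 by simp
    have "(M + 3) * (y gchoose (m + 3)) = (y - M - 2) * (y gchoose (m + 2))"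
      using gbinomial_Suc_mult[of "m + 2" y] by (simp add: M_def algebra_simps eval_nat_numeral)
    then have "(M + 3) * (y gchoose (m + 3)) = (M + 3) * ((y - M - 2) * (y - M - 1) * (y - M) * (M + 4) * d)" by (simp only: c2 mult_ac)
    then have c3: "y gchoose (m + 3) = (y - M - 2) * (y - M - 1) * (y - M) * (M + 4) * d" using M0 by simp
    have "(M + 4) * (y gchoose (m + 4)) = (y - M - 3) * (y gchoose (m + 3))"
      using gbinomial_Suc_mult[of "m + 3" y] by (simp add: M_def algebra_simps eval_nat_numeral)
    then have "(M + 4) * (y gchoose (m + 4)) = (M + 4) * ((y - M - 3) * (y - M - 2) * (y - M - 1) * (y - M) * d)" by (simp only: c3 mult_ac)
    then have c4: "y gchoose (m + 4) = (y - M - 3) * (y - M - 2) * (y - M - 1) * (y - M) * d" using M0 by simp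
    have p: "(x + 1) gchoose (j + 1) = (x gchoose j) + (x gchoose (j + 1))" for x :: rat and j
      using gbinomial_Suc_Suc[of x j] by simp
    have y12: "y + 1 + 1 = y + 2" "y + 2 + 1 = y + 3" by simp_all
    have b1: "(y + 1) gchoose (m + 3) = (y gchoose (m + 2)) + (y gchoose (m + 3))"
      "(y + 1) gchoose (m + 4) = (y gchoose (m + 3)) + (y gchoose (m + 4))"
      "(y + 1) gchoose (m + 2) = (y gchoose (m + 1)) + (y gchoose (m + 2))"
      "(y + 1) gchoose (m + 1) = (y gchoose m) + (y gchoose (m + 1))"
      using p[of y "m + 2"] p[of y "m + 3"] p[of y "m + 1"] p[of y m] by (simp_all add: eval_nat_numeral)
    have b2: "(y + 2) gchoose (m + 3) = ((y + 1) gchoose (m + 2)) + ((y + 1) gchoose (m + 3))"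
      "(y + 2) gchoose (m + 4) = ((y + 1) gchoose (m + 3)) + ((y + 1) gchoose (m + 4))"
      "(y + 2) gchoose (m + 2) = ((y + 1) gchoose (m + 1)) + ((y + 1) gchoose (m + 2))"
      using p[of "y + 1" "m + 2"] p[of "y + 1" "m + 3"] p[of "y + 1" "m + 1"] unfolding y12 by (simp_all add: eval_nat_numeral)
    have b3: "(y + 3) gchoose (m + 3) = ((y + 2) gchoose (m + 2)) + ((y + 2) gchoose (m + 3))"
      "(y + 3) gchoose (m + 4) = ((y + 2) gchoose (m + 3)) + ((y + 2) gchoose (m + 4))"
      using p[of "y + 2" "m + 2"] p[of "y + 2" "m + 3"] unfolding y12 by (simp_all add: eval_nat_numeral)
    have args: "z + of_nat (Suc k) = y + 3" "z + of_nat k = y + 2"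
      and ys: "y + 3 - 2 = y + 1" "y + 3 - 1 = y + 2" "y + 2 - 2 = y" "y + 2 - 1 = y + 1"
      and zK: "z = y + 2 - K"
      by (simp_all add: y_def K_def)
    have ns: "m + 4 - 1 = m + 3" "m + 3 - 1 = m + 2" by simp_all
    have rs: "of_nat (Suc k) = K + 1" "of_nat k = K" "of_nat (m + 4) = M + 4" "of_nat (m + 3) = M + 3"
      by (simp_all add: K_def M_def)
    have "psi z (m + 4) (Suc k) - psi z (m + 4) k = psi z (m + 3) k"
      unfolding psi_def psi_in_def psi_out_def args ns
      unfolding ys rs b3 b2 b1 c0 c1 c2 c3 c4 unfolding zK
      by algebra
    moreover have "Suc n = m + 4" using 3 by simp
    ultimately show ?thesis by (simp only: 3)
  qed
qed

text \<open>At \<open>k = i\<close> only the \<open>psi_in\<close> term of \<open>psi\<close>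
  survives, at \<open>k = 0\<close> only the \<open>psi_out\<close> term; the remaining factor
  \<open>i\<close> is absorbed into the binomial coefficients with lower index
  \<open>i\<close>.\<close>

lemma psi_endpoints:
  assumes "i \<ge> 1"
  shows "psi z i i - psi z i 0 = poly (Ptilde i) z"
proof -
  obtain j where i: "i = Suc j" using assms by (cases i) auto
  have X: "of_nat (Suc j) * ((z + of_nat j) gchoose Suc j) = (z + of_nat j) * ((z + of_nat j - 1) gchoose j)"
    by (rule gbinomial_absorption)
  have Y: "of_nat (Suc j) * (z gchoose Suc j) = (z - of_nat j) * (z gchoose j)"
    by (rule gbinomial_Suc_mult)
  have ar: "z + of_nat (Suc j) - 2 = z + of_nat j - 1" "z + of_nat (Suc j) - 1 = z + of_nat j" by simp_all
  have "psi z i i - psi z i 0 = of_nat (Suc j) * ((of_nat j + 2 * z) * ((z + of_nat j - 1) gchoose j))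
       - 2 * (of_nat (Suc j) * ((z + of_nat j) gchoose Suc j))
       - of_nat (Suc j) * ((2 * z - of_nat j) * (z gchoose j)) + 2 * (of_nat (Suc j) * (z gchoose Suc j))"
    unfolding psi_def psi_in_def psi_out_def i ar by (simp add: algebra_simps)
  also have "\<dots> = of_nat j * (2 * z + of_nat j - 1) * ((z + of_nat j - 1) gchoose j)
      + of_nat j * (of_nat j - 1 - 2 * z) * (z gchoose j)"
    unfolding X Y by (simp add: algebra_simps)
  also have "\<dots> = poly (Ptilde i) z"
  proof -
    \<comment> \<open>The lower indices \<open>i - 2\<close> and \<open>i - 3\<close> of
      \<open>Ptilde\<close> are both negative for \<open>i = 1\<close>, and the second one is for
      \<open>i = 2\<close>; there \<open>pbinom\<close> is 0 by convention.\<close>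
    consider "j = 0" | "j = 1" | m where "j = m + 2"
      by (metis One_nat_def add_2_eq_Suc' not0_implies_Suc)
    then show ?thesis
    proof cases
      case 1
      then show ?thesis by (simp add: Ptilde_def i poly_pbinom)
    next
      case 2
      then show ?thesis by (simp add: Ptilde_def i poly_pbinom poly_monom)
    next
      case 3
      define M where "M = (of_nat m :: rat)"
      define d where "d = ((z + M + 1) gchoose m) / ((M + 1) * (M + 2))"
      define e where "e = ((z - 2) gchoose m) / ((M + 1) * (M + 2))"
      have M0: "M + 1 \<noteq> 0" "M + 2 \<noteq> 0" unfolding M_def by (simp_all add: add_eq_0_iff_both_eq_0)
      have d0: "(z + M + 1) gchoose m = (M + 1) * (M + 2) * d" and e0: "(z - 2) gchoose m = (M + 1) * (M + 2) * e"
        using M0 by (simp_all add: d_def e_def)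
      have "(M + 1) * ((z + M + 1) gchoose Suc m) = (M + 1) * ((z + 1) * (M + 2) * d)"
        using gbinomial_Suc_mult[of m "z + M + 1"] d0 by (simp add: M_def[symmetric] algebra_simps)
      then have d1: "(z + M + 1) gchoose Suc m = (z + 1) * (M + 2) * d" using M0 by simp
      have "(M + 2) * ((z + M + 1) gchoose Suc (Suc m)) = (M + 2) * (z * (z + 1) * d)"
        using gbinomial_Suc_mult[of "Suc m" "z + M + 1"] d1 by (simp add: M_def[symmetric] algebra_simps)
      then have d2: "(z + M + 1) gchoose Suc (Suc m) = z * (z + 1) * d" using M0 by simp
      have "(M + 1) * ((z - 2) gchoose Suc m) = (M + 1) * ((z - 2 - M) * (M + 2) * e)"
        using gbinomial_Suc_mult[of m "z - 2"] e0 by (simp add: M_def[symmetric] algebra_simps)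
      then have e1: "(z - 2) gchoose Suc m = (z - 2 - M) * (M + 2) * e" using M0 by simp
      have "(M + 1) * ((z - 1) gchoose Suc m) = (M + 1) * ((z - 1) * (M + 2) * e)"
        using gbinomial_absorption[of m "z - 1"] e0 by (simp add: M_def[symmetric] algebra_simps)
      then have e1': "(z - 1) gchoose Suc m = (z - 1) * (M + 2) * e" using M0 by simp
      have "(M + 2) * (z gchoose Suc (Suc m)) = (M + 2) * (z * (z - 1) * e)"
        using gbinomial_absorption[of "Suc m" z] e1' by (simp add: M_def[symmetric] algebra_simps)
      then have e2: "z gchoose Suc (Suc m) = z * (z - 1) * e" using M0 by simp
      have j: "j = Suc (Suc m)" "of_nat j = M + 2" using 3 by (simp_all add: M_def)
      have a1: "z + of_nat j - 1 = z + M + 1" by (simp add: j(2))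
      have nt: "nat (1 + int m) = Suc m" by simp
      have P: "poly (Ptilde i) z = 2 * z^2 * (((z + M + 1) gchoose Suc m) - ((z - 2) gchoose Suc m))
          + z * (z + 1) * (((z + M + 1) gchoose m) - ((z - 2) gchoose m))"
        by (simp add: Ptilde_def i j(1) poly_pbinom poly_monom M_def nt algebra_simps nat_add_distrib)
      show ?thesis unfolding P a1 unfolding j(2) unfolding j(1) d0 d1 d2 e0 e1 e2
        by algebra
    qed
  qed
  finally show ?thesis .
qed

lemma pairing_psi_theta:
  assumes "i \<ge> 1"
  shows "pairing (psi z (i + s)) ((monom 1 1 - 1) ^ s * qfac i) = poly (Ptilde i) z"
proof (induction s)
  case 0
  have "pairing (psi z i) (qfac i) = psi z i i - psi z i 0"
    using pairing_monom_mult[of "psi z i" i 1] by (simp add: pairing_diff)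
  then show ?case using psi_endpoints[OF assms, of z] by simp
next
  case (Suc s)
  define f where "f = (monom 1 1 - 1) ^ s * qfac i"
  have "pairing (psi z (i + Suc s)) ((monom 1 1 - 1) ^ Suc s * qfac i)
      = pairing (psi z (Suc (i + s))) (monom 1 1 * f - f)"
    by (simp add: f_def algebra_simps)
  also have "\<dots> = pairing (\<lambda>k. psi z (Suc (i + s)) (Suc k) - psi z (Suc (i + s)) k) f"
    unfolding pairing_diff pairing_monom_mult
    using pairing_lincomb[of 1 "\<lambda>k. psi z (Suc (i + s)) (Suc k)" "-1"] by simp
  also have "\<dots> = pairing (psi z (i + s)) f" using assms by (simp add: psi_step)
  finally show ?case using Suc by (simp add: f_def)
qed

section \<open>Conjugation and the final computation\<close>

text \<open>Iterates of the two cycles from chosen base points are matched; only the wrap-around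
  \<open>Suc i = m\<close>, where both walks return to their base points, needs an argument.\<close>

lemma full_cycles_bij:
  assumes "finite T" "T \<noteq> {}" "finite T'" "card T = card T'" "\<zeta> \<in> full_cycles T" "\<zeta>' \<in> full_cycles T'"
  obtains h where "bij_betw h T T'" "\<And>x. x \<in> T \<Longrightarrow> h (\<zeta> x) = \<zeta>' (h x)"
proof -
  define m where "m = card T"
  obtain t where t: "t \<in> T" using assms(2) by blast
  have "T' \<noteq> {}" using assms(1,2,4) by auto
  then obtain t' where t': "t' \<in> T'" by blast
  have \<zeta>: "\<zeta> permutes T" "cycles_on T \<zeta> = {T}" and \<zeta>': "\<zeta>' permutes T'" "cycles_on T' \<zeta>' = {T'}"
    using assms(5,6) by (auto simp: full_cycles_def)
  have o: "orbit \<zeta> t = T" by (rule cycles_onD(4)[OF \<zeta>(1) assms(1) _ t]) (simp add: \<zeta>)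
  have o': "orbit \<zeta>' t' = T'" by (rule cycles_onD(4)[OF \<zeta>'(1) assms(3) _ t']) (simp add: \<zeta>')
  define f where "f i = (\<zeta> ^^ i) t" for i
  define f' where "f' i = (\<zeta>' ^^ i) t'" for i
  note oc = orbit_card_funpow[OF \<zeta>(1) assms(1), of t, unfolded o, folded f_def m_def]
  note oc' = orbit_card_funpow[OF \<zeta>'(1) assms(3), of t', unfolded o', folded f'_def assms(4) m_def]
  have b: "bij_betw f {..<m} T" using oc(1,2) by (simp add: bij_betw_def)
  have b': "bij_betw f' {..<m} T'" using oc'(1,2) by (simp add: bij_betw_def)
  define h where "h = f' \<circ> inv_into {..<m} f"
  have hb: "bij_betw h T T'"
    unfolding h_def by (rule bij_betw_trans[OF bij_betw_inv_into[OF b] b'])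
  have hf: "h (f i) = f' i" if "i < m" for i
    using that inv_into_f_f[OF bij_betw_imp_inj_on[OF b], of i] by (simp add: h_def)
  have "h (\<zeta> x) = \<zeta>' (h x)" if x: "x \<in> T" for x
  proof -
    obtain i where i: "i < m" "x = f i" using x oc(1) by auto
    have s: "\<zeta> x = f (Suc i)" "\<zeta>' (f' i) = f' (Suc i)" by (simp_all add: i f_def f'_def)
    have "h (f (Suc i)) = f' (Suc i)"
    proof (cases "Suc i < m")
      case True
      then show ?thesis by (rule hf)
    next
      case False
      then have "Suc i = m" using i by simp
      moreover have "f m = f 0" "f' m = f' 0" using oc(3) oc'(3) by (simp_all add: f_def f'_def)
      ultimately show ?thesis using hf[OF oc(4)] by simp
    qed
    then show ?thesis using hf[OF i(1)] s i by simp
  qed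
  with hb that show ?thesis by blast
qed

text \<open>Ensures that the class size by which \<open>P_poly\<close> divides is not 0.\<close>

lemma ex_perm_of_type:
  assumes "\<And>b. b \<in># \<beta> \<Longrightarrow> b > 0" "finite S" "card S = sum_mset \<beta>"
  shows "\<exists>p. p permutes S \<and> image_mset card (mset_set (cycles_on S p)) = \<beta>"
  using assms
proof (induction \<beta> arbitrary: S)
  case empty
  then show ?case by (auto simp: cycles_on_def intro!: exI[of _ id] permutes_id)
next
  case (add b \<beta>)
  have "b \<le> card S" using add.prems by simp
  then obtain T where T: "T \<subseteq> S" "card T = b" "finite T" using add.prems(2) by (metis obtain_subset_with_card_n)
  have "b > 0" using add.prems by simp
  then have Tne: "T \<noteq> {}" using T by auto
  have "card (S - T) = sum_mset \<beta>" using T add.prems by (simp add: card_Diff_subset)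
  then obtain p where p: "p permutes (S - T)" "image_mset card (mset_set (cycles_on (S - T) p)) = \<beta>"
    using add.IH[of "S - T"] add.prems by auto
  have "full_cycles T \<noteq> {}" using card_full_cycles[OF T(3) Tne] by auto
  then obtain \<zeta> where \<zeta>: "\<zeta> permutes T" "cycles_on T \<zeta> = {T}"
    unfolding full_cycles_def by blast
  define q where "q = p \<circ> \<zeta>"
  have q: "q permutes S"
    unfolding q_def using permutes_subset[OF \<zeta>(1) T(1)] permutes_subset[OF p(1), of S]
    by (intro permutes_compose) auto
  have oT: "orbit q x = T" if "x \<in> T" for x
  proof -
    have "orbit \<zeta> x = T" by (rule cycles_onD(4)[OF \<zeta>(1) T(3) _ that]) (simp add: \<zeta>)
    moreover have "orbit q x = orbit \<zeta> x"
    proof (rule orbit_cong[OF mem_orbit_self[OF \<zeta>(1) T(3)]])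
      fix y assume "y \<in> orbit \<zeta> x"
      then have "\<zeta> y \<in> T" using permutes_orbit_subset[OF \<zeta>(1) that] permutes_in_image[OF \<zeta>(1)] by blast
      then show "q y = \<zeta> y" unfolding q_def using permutes_not_in[OF p(1)] by simp
    qed
    ultimately show ?thesis by simp
  qed
  have oST: "orbit q x = orbit p x" if "x \<in> S - T" for x
  proof (rule orbit_cong[OF mem_orbit_self[OF p(1)]])
    fix y assume "y \<in> orbit p x"
    then have "y \<in> S - T" using permutes_orbit_subset[OF p(1) that] by blast
    then show "q y = p y" unfolding q_def using permutes_not_in[OF \<zeta>(1)] by simp
  qed (use add.prems in simp)
  have "cycles_on S q = orbit q ` T \<union> orbit q ` (S - T)" unfolding cycles_on_def using T(1) by blast
  also have "orbit q ` T = {T}" using oT Tne by auto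
  also have "orbit q ` (S - T) = cycles_on (S - T) p" unfolding cycles_on_def using oST by (intro image_cong) auto
  finally have "cycles_on S q = insert T (cycles_on (S - T) p)" by simp
  moreover have "T \<notin> cycles_on (S - T) p"
    using cycles_onD(1)[OF p(1), of T] add.prems(2) Tne by blast
  ultimately have "image_mset card (mset_set (cycles_on S q)) = add_mset b \<beta>"
    using p(2) T(2) add.prems(2) by simp
  then show ?case using q by blast
qed

text \<open>Erasing one point \<open>a\<close> of a 2-cycle leaves its partner \<open>b\<close>
  fixed, so what remains is a full cycle on the complement of both.\<close>

lemma two_cycle_decomp:
  assumes "finite S" "\<alpha> permutes S" "image_mset card (mset_set (cycles_on S \<alpha>)) = {#2, m#}"
  obtains a b \<zeta> where "a \<in> S" "b \<in> S - {a}" "\<zeta> \<in> full_cycles (S - {a, b})" "\<alpha> = \<zeta> \<circ> transpose b a"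
proof -
  define X where "X = cycles_on S \<alpha>"
  have finX: "finite X" using assms(1) by (simp add: X_def)
  have "2 \<in># image_mset card (mset_set X)" using assms(3) by (simp add: X_def)
  then obtain C where C: "C \<in> X" "card C = 2" using finX by auto
  have "image_mset card (mset_set X) = add_mset 2 (image_mset card (mset_set (X - {C})))"
    by (simp only: mset_set.remove[OF finX C(1)] image_mset_add_mset C(2))
  then have "image_mset card (mset_set (X - {C})) = {#m#}" using assms(3) by (simp add: X_def)
  then have "size (image_mset card (mset_set (X - {C}))) = 1" by simp
  then have "card (X - {C}) = 1" by simp
  then obtain D where D: "X - {C} = {D}" by (rule card_1_singletonE)
  obtain a b where ab: "C = {a, b}" "a \<noteq> b" using C(2) unfolding card_2_iff by blast
  have CX: "C \<in> cycles_on S \<alpha>" "D \<in> cycles_on S \<alpha>" "C \<noteq> D" using C D unfolding X_def by auto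
  have oa: "orbit \<alpha> a = C" "orbit \<alpha> b = C" using cycles_onD(4)[OF assms(2,1) CX(1)] ab by auto
  have abS: "a \<in> S" "b \<in> S" using cycles_onD(1)[OF assms(2,1) CX(1)] ab by auto
  have "\<alpha> a \<noteq> a" using oa(1) ab orbit_eq_singleton_iff[of \<alpha> a] by auto
  then have \<alpha>a: "\<alpha> a = b" using orbit.base[of \<alpha> a] oa ab by auto
  have "\<alpha> b \<noteq> \<alpha> a" using ab(2) permutes_inj[OF assms(2)] by (auto dest: injD)
  then have \<alpha>b: "\<alpha> b = a" using orbit.base[of \<alpha> b] oa ab \<alpha>a by auto
  define \<zeta> where "\<zeta> = perm_delete a \<alpha>"
  have \<zeta>a: "\<zeta> permutes (S - {a})" unfolding \<zeta>_def by (rule perm_delete_permutes[OF assms(2) abS(1)])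
  have "cycles_on (S - {a}) \<zeta> = {D, {b}}"
    unfolding \<zeta>_def cycles_on_perm_delete[OF assms(2,1) abS(1)] using D oa \<alpha>a ab X_def by auto
  have \<zeta>b: "\<zeta> b = b" using \<alpha>a \<alpha>b by (simp add: \<zeta>_def perm_delete_def)
  have "{b} \<noteq> D" using cycles_on_disjoint[OF assms(2,1) CX] ab by auto
  then have c: "cycles_on (S - {a, b}) \<zeta> = {D}"
    unfolding Diff_insert2[of S a "{b}"]
    using cycles_on_fixed(1)[OF \<zeta>a _ _ \<zeta>b] assms(1) abS ab \<open>cycles_on (S - {a}) \<zeta> = _\<close> by auto
  have D': "D = S - {a, b}"
  proof -
    have "S = \<Union>X" unfolding X_def using Union_cycles_on[OF assms(2,1)] by simp
    also have "X = {C, D}" using D C by auto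
    finally show ?thesis using cycles_on_disjoint[OF assms(2,1) CX] ab by auto
  qed
  have "\<zeta> permutes (S - {a, b})"
    by (rule permutes_superset[OF \<zeta>a]) (use \<zeta>b in auto)
  then have fc: "\<zeta> \<in> full_cycles (S - {a, b})"
    using c unfolding full_cycles_def D' by blast
  have eq: "\<alpha> = \<zeta> \<circ> transpose b a"
  proof
    fix x
    have "\<alpha> x = a \<longleftrightarrow> x = b" "\<alpha> x = b \<longleftrightarrow> x = a"
      using inj_eq[OF permutes_inj[OF assms(2)], of x b] inj_eq[OF permutes_inj[OF assms(2)], of x a]
      unfolding \<alpha>a \<alpha>b by simp_all
    then show "\<alpha> x = (\<zeta> \<circ> transpose b a) x"
      using \<alpha>a \<alpha>b ab(2) by (cases "x = a"; cases "x = b") (auto simp: \<zeta>_def perm_delete_def)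
  qed
  have "b \<in> S - {a}" using abS ab(2) by simp
  then show ?thesis by (rule that[OF abS(1) _ fc eq])
qed

text \<open>All products occurring in the triple sum are conjugate: the ordered 2-cycles are matched
  pointwise and the long cycles by \<open>full_cycles_bij\<close>.\<close>

lemma two_cycle_conjugate:
  assumes "finite S" "a \<in> S" "b \<in> S - {a}" "\<zeta> \<in> full_cycles (S - {a, b})" "S - {a, b} \<noteq> {}"
    "a' \<in> S" "b' \<in> S - {a'}" "\<zeta>' \<in> full_cycles (S - {a', b'})"
  obtains g where "g permutes S" "g \<circ> (\<zeta> \<circ> transpose b a) = (\<zeta>' \<circ> transpose b' a') \<circ> g"
proof -
  define T where "T = S - {a, b}"
  define T' where "T' = S - {a', b'}"
  have S: "S = insert a (insert b T)" "a \<noteq> b" "a \<notin> T" "b \<notin> T" using assms by (auto simp: T_def)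
  have S': "S = insert a' (insert b' T')" "a' \<noteq> b'" "a' \<notin> T'" "b' \<notin> T'" using assms by (auto simp: T'_def)
  have fin: "finite T" "finite T'" using assms by (auto simp: T_def T'_def)
  have "card S = Suc (Suc (card T))" unfolding S(1) using S(2-4) fin by simp
  moreover have "card S = Suc (Suc (card T'))" unfolding S'(1) using S'(2-4) fin by simp
  ultimately have cardT: "card T = card T'" by simp
  have \<zeta>: "\<zeta> permutes T" "\<zeta>' permutes T'" using assms by (auto simp: full_cycles_def T_def T'_def)
  obtain h where h: "bij_betw h T T'" "\<And>x. x \<in> T \<Longrightarrow> h (\<zeta> x) = \<zeta>' (h x)"
    by (rule full_cycles_bij[OF fin(1) assms(5)[folded T_def] fin(2) cardT
        assms(4)[folded T_def] assms(8)[folded T'_def]])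
      (rule that)
  define g where "g x = (if x = a then a' else if x = b then b' else if x \<in> T then h x else x)" for x
  have gT: "g x = h x" if "x \<in> T" for x using that S(3,4) by (auto simp: g_def)
  have gab: "g a = a'" "g b = b'" using S(2) by (auto simp: g_def)
  have go: "g x = x" if "x \<notin> S" for x
  proof -
    have "x \<noteq> a" "x \<noteq> b" "x \<notin> T" using that S(1) by blast+
    then show ?thesis by (simp add: g_def)
  qed
  have hT: "h x \<in> T'" if "x \<in> T" for x using h(1) that by (auto simp: bij_betw_def)
  have "bij_betw g T T'" using h(1) bij_betw_cong[of T g h T'] gT by blast
  then have "bij_betw g (insert b T) (insert b' T')"
    using notIn_Un_bij_betw[of b T g T'] S(2-4) S'(2-4) gab by simp
  then have "bij_betw g (insert a (insert b T)) (insert a' (insert b' T'))"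
    using notIn_Un_bij_betw[of a "insert b T" g "insert b' T'"] S(2-4) S'(2-4) gab by simp
  then have "bij_betw g S S" unfolding S(1)[symmetric] S'(1)[symmetric] .
  then have g: "g permutes S" using go by (rule bij_imp_permutes)
  have z: "\<zeta> a = a" "\<zeta> b = b" "\<zeta>' a' = a'" "\<zeta>' b' = b'" using \<zeta> S(3,4) S'(3,4) by (simp_all add: permutes_not_in)
  have "g ((\<zeta> \<circ> transpose b a) x) = (\<zeta>' \<circ> transpose b' a') (g x)" for x
  proof -
    consider "x = a" | "x = b" | "x \<in> T" | "x \<notin> S" using S(1) by blast
    then show ?thesis
    proof cases
      case 3
      then have "x \<noteq> a" "x \<noteq> b" "h x \<noteq> a'" "h x \<noteq> b'" using S(3,4) S'(3,4) hT[of x] by blast+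
      moreover have "\<zeta> x \<in> T" using permutes_in_image[OF \<zeta>(1)] 3 by simp
      ultimately show ?thesis using 3 gT h(2) by simp
    next
      case 4
      then have "x \<noteq> a" "x \<noteq> b" "x \<noteq> a'" "x \<noteq> b'" "x \<notin> T" "x \<notin> T'"
        using S(1) S'(1) by blast+
      then show ?thesis using go[OF 4] \<zeta> by (simp add: permutes_not_in)
    qed (use gab z in simp_all)
  qed
  then have "g \<circ> (\<zeta> \<circ> transpose b a) = (\<zeta>' \<circ> transpose b' a') \<circ> g" by (simp add: fun_eq_iff)
  then show ?thesis by (rule that[OF g])
qed

section \<open>Invariance of class sums under conjugation\<close>

lemma cycles_on_conj:
  assumes "finite S" "g permutes S" "p permutes S" "q permutes S" "g \<circ> p = q \<circ> g"
  shows "cycles_on S q = (\<lambda>C. g ` C) ` cycles_on S p"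
proof -
  have "q (g y) = g (p y)" for y using fun_cong[OF assms(5), of y] by simp
  then have "g ` orbit p x = orbit q (g x)" for x
    by (intro orbit_inverse mem_orbit_self[OF assms(3,1)])
  then have "(\<lambda>C. g ` C) ` cycles_on S p = orbit q ` (g ` S)" by (simp add: cycles_on_def image_image)
  then show ?thesis using permutes_image[OF assms(2)] by (simp add: cycles_on_def)
qed

lemma inj_image_image: "inj g \<Longrightarrow> inj_on ((`) g) A"
  by (simp add: inj_on_def inj_image_eq_iff)

lemma num_cycles_conj:
  assumes "g permutes {1..n}" "p permutes {1..n}" "q permutes {1..n}" "g \<circ> p = q \<circ> g"
  shows "num_cycles n q = num_cycles n p" "cycle_type n q = cycle_type n p"
proof -
  have inj: "inj g" by (rule permutes_inj[OF assms(1)])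
  have c: "cycles n q = (\<lambda>C. g ` C) ` cycles n p"
    using cycles_on_conj[OF _ assms] by (simp add: cycles_def cycles_on_def)
  show "num_cycles n q = num_cycles n p"
    unfolding num_cycles_def c by (rule card_image[OF inj_image_image[OF inj]])
  have "mset_set ((\<lambda>C. g ` C) ` cycles n p) = image_mset (\<lambda>C. g ` C) (mset_set (cycles n p))"
    by (rule image_mset_mset_set[symmetric, OF inj_image_image[OF inj]])
  moreover have "card (g ` C) = card C" for C
    by (rule card_image[OF inj_on_subset[OF inj]]) simp
  ultimately show "cycle_type n q = cycle_type n p"
    unfolding cycle_type_def c by (simp add: image_mset.compositionality comp_def)
qed

text \<open>The product \<open>\<alpha>' \<circ> \<omega>\<close> is conjugate under
  \<open>g\<close> to \<open>\<alpha> \<circ> (inv g \<circ> \<omega> \<circ> g)\<close>, and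
  conjugation by \<open>g\<close> permutes the class of type \<open>\<beta>\<close>.\<close>

lemma sum_over_type_conj:
  fixes G :: "nat \<Rightarrow> rat"
  assumes "g permutes {1..n}" "\<alpha> permutes {1..n}" "\<alpha>' permutes {1..n}" "g \<circ> \<alpha> = \<alpha>' \<circ> g"
  shows "(\<Sum>\<omega>\<in>perms_of_type n \<beta>. G (num_cycles n (\<alpha>' \<circ> \<omega>))) = (\<Sum>\<omega>\<in>perms_of_type n \<beta>. G (num_cycles n (\<alpha> \<circ> \<omega>)))"
proof (rule sum.reindex_bij_witness[of _ "\<lambda>\<omega>. g \<circ> \<omega> \<circ> inv g" "\<lambda>\<omega>. inv g \<circ> \<omega> \<circ> g"])
  have ig: "inv g permutes {1..n}" by (rule permutes_inv[OF assms(1)])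
  have gi: "g \<circ> inv g = id" "inv g \<circ> g = id" using permutes_inv_o[OF assms(1)] by auto
  have gi': "g (inv g x) = x" "inv g (g x) = x" for x using permutes_inverses[OF assms(1)] by auto
  fix \<omega> assume \<omega>: "\<omega> \<in> perms_of_type n \<beta>"
  then have p: "\<omega> permutes {1..n}" and t: "cycle_type n \<omega> = \<beta>" by (auto simp: perms_of_type_def)
  show "g \<circ> (inv g \<circ> \<omega> \<circ> g) \<circ> inv g = \<omega>" "inv g \<circ> (g \<circ> \<omega> \<circ> inv g) \<circ> g = \<omega>"
    by (auto simp: fun_eq_iff gi')
  have p1: "(g \<circ> \<omega> \<circ> inv g) permutes {1..n}" and p2: "(inv g \<circ> \<omega> \<circ> g) permutes {1..n}"
    using p ig assms(1) by (auto intro!: permutes_compose)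
  have "cycle_type n (g \<circ> \<omega> \<circ> inv g) = cycle_type n \<omega>"
    by (rule num_cycles_conj(2)[OF assms(1) p p1]) (auto simp: fun_eq_iff gi')
  then show "g \<circ> \<omega> \<circ> inv g \<in> perms_of_type n \<beta>" using t p1 by (simp add: perms_of_type_def)
  have "cycle_type n (inv g \<circ> \<omega> \<circ> g) = cycle_type n \<omega>"
    by (rule num_cycles_conj(2)[OF ig p p2]) (auto simp: fun_eq_iff gi')
  then show "inv g \<circ> \<omega> \<circ> g \<in> perms_of_type n \<beta>" using t p2 by (simp add: perms_of_type_def)
  have "num_cycles n (\<alpha>' \<circ> \<omega>) = num_cycles n (\<alpha> \<circ> (inv g \<circ> \<omega> \<circ> g))"
  proof (rule num_cycles_conj(1)[OF assms(1)])
    show "(\<alpha> \<circ> (inv g \<circ> \<omega> \<circ> g)) permutes {1..n}" "(\<alpha>' \<circ> \<omega>) permutes {1..n}"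
      by (intro permutes_compose p2 assms p)+
    show "g \<circ> (\<alpha> \<circ> (inv g \<circ> \<omega> \<circ> g)) = \<alpha>' \<circ> \<omega> \<circ> g"
      using fun_cong[OF assms(4)] by (auto simp: fun_eq_iff gi')
  qed
  then show "G (num_cycles n (\<alpha> \<circ> (inv g \<circ> \<omega> \<circ> g))) = G (num_cycles n (\<alpha>' \<circ> \<omega>))" by simp
qed

text \<open>The outer variable of \<open>rat poly poly\<close> is \<open>y\<close>, so
  \<open>poly _ 1\<close> is the specialisation \<open>y = 1\<close>, under which \<open>x\<close>
  becomes \<open>q\<close>, that is \<open>monom 1 1\<close>.\<close>

lemma qfac_expansion:
  assumes "is_expansion n \<beta> a"
  shows "(\<Prod>g\<in>#\<beta>. qfac g) = (\<Sum>i=1..n. smult (a i) ((monom 1 1 - 1) ^ (n - i) * qfac i))"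
proof -
  have x: "poly xvar 1 = monom 1 1" and y: "poly yvar 1 = 1"
    by (simp_all add: xvar_def yvar_def monom_altdef)
  have "poly (rho \<beta>) 1 = (\<Prod>g\<in>#\<beta>. qfac g)"
    unfolding rho_def by (induction \<beta>) (simp_all add: x y poly_power monom_power)
  moreover have "poly (rho (theta n i)) 1 = (monom 1 1 - 1) ^ (n - i) * qfac i" for i
    by (simp add: rho_theta x y poly_power monom_power)
  then have "poly (\<Sum>i=1..n. smult [:a i:] (rho (theta n i))) 1 = (\<Sum>i=1..n. smult (a i) ((monom 1 1 - 1) ^ (n - i) * qfac i))"
    by (simp add: poly_sum)
  ultimately show ?thesis using assms unfolding is_expansion_def by simp
qed

theorem theorem3p14:
  fixes n :: nat and \<beta> :: "nat multiset" and \<alpha> :: "nat \<Rightarrow> nat"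
  assumes "sum_mset \<beta> = n" and "size \<beta> \<ge> 1" and "\<And>b. b \<in># \<beta> \<Longrightarrow> b \<ge> 3"
    and "\<alpha> \<in> perms_of_type n {#2, n - 2#}"
  shows "P_poly n \<alpha> \<beta> = (\<Sum>i=1..n. smult (a_coeff n \<beta> i) (Ptilde i))"
proof -
  define S where "S = {1..n}"
  define \<Omega> where "\<Omega> = perms_of_type n \<beta>"
  have finS: "finite S" and cardS: "card S = n" by (simp_all add: S_def)
  have cyc: "cycles n p = cycles_on S p" for p by (simp add: cycles_def cycles_on_def S_def)
  have \<beta>ne: "\<beta> \<noteq> {#}" using assms(2) by auto
  then obtain b \<beta>' where b: "\<beta> = add_mset b \<beta>'" by (meson multiset_cases)
  then have n3: "n \<ge> 3" using assms(1) assms(3)[of b] by simp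
  have fin\<Omega>: "finite \<Omega>"
    unfolding \<Omega>_def perms_of_type_def by (rule finite_subset[OF _ finite_permutations[of "{1..n}"]]) auto
  have "b > 0" if "b \<in># \<beta>" for b using assms(3)[OF that] by simp
  then obtain p where "p permutes S" "image_mset card (mset_set (cycles_on S p)) = \<beta>"
    using ex_perm_of_type[of \<beta> S] finS cardS assms(1) by auto
  then have "p \<in> \<Omega>"
    unfolding \<Omega>_def perms_of_type_def cycle_type_def cyc S_def by blast
  then have "\<Omega> \<noteq> {}" by blast
  then have card\<Omega>: "card \<Omega> \<noteq> 0" using fin\<Omega> by simp
  have \<omega>S: "\<omega> permutes S" and \<omega>\<beta>: "image_mset card (mset_set (cycles_on S \<omega>)) = \<beta>" if "\<omega> \<in> \<Omega>" for \<omega>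
    using that by (simp_all add: \<Omega>_def perms_of_type_def cycle_type_def cyc S_def)
  have \<alpha>S: "\<alpha> permutes S" and \<alpha>t: "image_mset card (mset_set (cycles_on S \<alpha>)) = {#2, n - 2#}"
    using assms(4) by (simp_all add: perms_of_type_def cycle_type_def cyc S_def)
  obtain a0 b0 \<zeta>0 where \<alpha>0: "a0 \<in> S" "b0 \<in> S - {a0}" "\<zeta>0 \<in> full_cycles (S - {a0, b0})" "\<alpha> = \<zeta>0 \<circ> transpose b0 a0"
    by (rule two_cycle_decomp[OF finS \<alpha>S \<alpha>t])
  have card2: "card (S - {a, b}) = n - 2" if "a \<in> S" "b \<in> S - {a}" for a b
    using that finS cardS by (subst card_Diff_subset) auto
  have ne2: "S - {a, b} \<noteq> {}" if "a \<in> S" "b \<in> S - {a}" for a b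
    using card2[OF that] n3 by (metis card.empty diff_is_0_eq not_less_eq_eq numeral_2_eq_2 numeral_3_eq_3)
  have main: "poly (P_poly n \<alpha> \<beta>) z = pairing (psi z n) (\<Prod>g\<in>#\<beta>. qfac g)" for z
  proof -
    define Q where "Q \<alpha> = (\<Sum>\<omega>\<in>\<Omega>. z ^ num_cycles n (\<alpha> \<circ> \<omega>))" for \<alpha>
    \<comment> \<open>The triples \<open>(a, b, \<zeta>)\<close> and \<open>(b, a, \<zeta>)\<close>
      give the same permutation. This does no harm: as \<open>Q\<close> is constant on the triples,
      only their number matters.\<close>
    have Q: "Q (\<zeta> \<circ> transpose b a) = Q \<alpha>" if ab: "a \<in> S" "b \<in> S - {a}" "\<zeta> \<in> full_cycles (S - {a, b})" for a b \<zeta>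
    proof -
      obtain g where g: "g permutes S" "g \<circ> \<alpha> = (\<zeta> \<circ> transpose b a) \<circ> g"
        unfolding \<alpha>0(4) by (rule two_cycle_conjugate[OF finS \<alpha>0(1-3) ne2[OF \<alpha>0(1,2)] ab])
      have "\<zeta> permutes S" by (rule permutes_subset[of _ "S - {a, b}"]) (use ab in \<open>auto simp: full_cycles_def\<close>)
      then have "(\<zeta> \<circ> transpose b a) permutes S"
        using ab by (intro permutes_compose permutes_swap_id) auto
      then show ?thesis
        using sum_over_type_conj[of g n \<alpha> "\<zeta> \<circ> transpose b a" "\<lambda>k. z ^ k" \<beta>] g \<alpha>S
        unfolding Q_def \<Omega>_def S_def by simp
    qed
    have "(\<Sum>a\<in>S. \<Sum>b\<in>S - {a}. \<Sum>\<zeta>\<in>full_cycles (S - {a, b}). Q (\<zeta> \<circ> transpose b a))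
        = (\<Sum>a\<in>S. \<Sum>b\<in>S - {a}. fact (n - 3) * Q \<alpha>)"
    proof (intro sum.cong refl)
      fix a b assume ab: "a \<in> S" "b \<in> S - {a}"
      have "card (full_cycles (S - {a, b})) = fact (n - 3)"
        using card_full_cycles[of "S - {a, b}"] ne2[OF ab] finS card2[OF ab] by simp
      then show "(\<Sum>\<zeta>\<in>full_cycles (S - {a, b}). Q (\<zeta> \<circ> transpose b a)) = fact (n - 3) * Q \<alpha>"
        using Q[OF ab] by simp
    qed
    also have "\<dots> = of_nat (n * (n - 1)) * (fact (n - 3) * Q \<alpha>)"
      using finS by (simp add: cardS)
    finally have 1: "(\<Sum>a\<in>S. \<Sum>b\<in>S - {a}. \<Sum>\<zeta>\<in>full_cycles (S - {a, b}). Q (\<zeta> \<circ> transpose b a))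
        = of_nat (n * (n - 1)) * (fact (n - 3) * Q \<alpha>)" .
    \<comment> \<open>With the order of summation exchanged, \<open>\<omega>\<close> is fixed and
      the triple varies; the inner sum then depends only on the cycle lengths of
      \<open>\<omega>\<close>, that is on \<open>\<beta>\<close>.\<close>
    have "(\<Sum>a\<in>S. \<Sum>b\<in>S - {a}. \<Sum>\<zeta>\<in>full_cycles (S - {a, b}). Q (\<zeta> \<circ> transpose b a))
        = (\<Sum>\<omega>\<in>\<Omega>. \<Sum>a\<in>S. \<Sum>b\<in>S - {a}. \<Sum>\<zeta>\<in>full_cycles (S - {a, b}). z ^ card (cycles_on S (\<zeta> \<circ> (transpose b a \<circ> \<omega>))))"
      unfolding Q_def num_cycles_def cyc comp_assoc by (simp only: sum.swap[of _ \<Omega>])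
    also have "\<dots> = (\<Sum>\<omega>\<in>\<Omega>. fact (n - 3) * pairing (psi z n) (\<Prod>g\<in>#\<beta>. qfac g))"
    proof (intro sum.cong refl)
      fix \<omega> assume \<omega>: "\<omega> \<in> \<Omega>"
      have "(\<Prod>C\<in>cycles_on S \<omega>. qfac (card C)) = (\<Prod>g\<in>#\<beta>. qfac g)"
        unfolding \<omega>\<beta>[OF \<omega>, symmetric] by (simp add: prod_unfold_prod_mset image_mset.compositionality comp_def)
      moreover have "card C \<ge> 3" if "C \<in> cycles_on S \<omega>" for C
      proof (rule assms(3))
        show "card C \<in># \<beta>" unfolding \<omega>\<beta>[OF \<omega>, symmetric] using that finS by simp
      qed
      ultimately show "(\<Sum>a\<in>S. \<Sum>b\<in>S - {a}. \<Sum>\<zeta>\<in>full_cycles (S - {a, b}). z ^ card (cycles_on S (\<zeta> \<circ> (transpose b a \<circ> \<omega>))))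
         = fact (n - 3) * pairing (psi z n) (\<Prod>g\<in>#\<beta>. qfac g)"
        using sum_two_points_pairing[OF finS \<omega>S[OF \<omega>], of z] by (simp only: cardS)
    qed
    finally have "of_nat (n * (n - 1)) * (fact (n - 3) * Q \<alpha>)
        = of_nat (card \<Omega>) * (fact (n - 3) * pairing (psi z n) (\<Prod>g\<in>#\<beta>. qfac g))"
      unfolding 1 by simp
    then have "fact (n - 3) * (of_nat (n * (n - 1)) * Q \<alpha>)
        = fact (n - 3) * (of_nat (card \<Omega>) * pairing (psi z n) (\<Prod>g\<in>#\<beta>. qfac g))"
      by (simp only: mult.left_commute)
    then have "of_nat (n * (n - 1)) * Q \<alpha> = of_nat (card \<Omega>) * pairing (psi z n) (\<Prod>g\<in>#\<beta>. qfac g)"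
      by simp
    moreover have "poly (P_poly n \<alpha> \<beta>) z = of_nat (n * (n - 1)) / of_nat (card \<Omega>) * Q \<alpha>"
      by (simp add: P_poly_def Q_def \<Omega>_def poly_sum poly_monom)
    ultimately show ?thesis using card\<Omega> by (simp add: field_simps)
  qed
  have "poly (P_poly n \<alpha> \<beta>) z = poly (\<Sum>i=1..n. smult (a_coeff n \<beta> i) (Ptilde i)) z" for z
  proof -
    have "poly (P_poly n \<alpha> \<beta>) z
        = (\<Sum>i=1..n. a_coeff n \<beta> i * pairing (psi z n) ((monom 1 1 - 1) ^ (n - i) * qfac i))"
      unfolding main qfac_expansion[OF is_expansion_a_coeff[OF assms(1) \<beta>ne]] pairing_sum pairing_smult ..
    also have "\<dots> = (\<Sum>i=1..n. a_coeff n \<beta> i * poly (Ptilde i) z)"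
    proof (intro sum.cong refl)
      fix i assume "i \<in> {1..n}"
      then show "a_coeff n \<beta> i * pairing (psi z n) ((monom 1 1 - 1) ^ (n - i) * qfac i) = a_coeff n \<beta> i * poly (Ptilde i) z"
        using pairing_psi_theta[of i z "n - i"] by simp
    qed
    finally show ?thesis by (simp add: poly_sum)
  qed
  then have "poly (P_poly n \<alpha> \<beta>) = poly (\<Sum>i=1..n. smult (a_coeff n \<beta> i) (Ptilde i))" by (rule ext)
  then show ?thesis by (simp only: poly_eq_poly_eq_iff)
qed

end
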